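(* Let $p\ge 1$ be an integer, let $L>0$, $c>0$, $v_0<c$, $t_1>0$, and let $\boldsymbol\partial$ be a $p$th order accurate centered finite difference operator (as specified in the context) with associated function $\hat P$. Let $g:\mathbb{R}\to\mathbb{R}$ be $p+2$ times continuously differentiable with $g(t)=0$ for $t\le 0$ and for $t\ge t_1$. Let $F$ be an admissible source profile (as specified in the context) that satisfies $p$ moment conditions and $p+1$ sonic boom conditions. Let $u$ be the exact solution of the $L$-periodic advection problem $u_t+cu_x=g(t)\,\delta(x-v_0t)$, $u(\cdot,0)=0$, and let $\mathbf u$ be the solution of the semidiscrete problem $\frac{d\mathbf u}{dt}+c\,\boldsymbol\partial\mathbf u=g(t)\,\boldsymbol\delta^{v_0t}$, $\mathbf u(0)=0$, on the grid with $M=2N+1$ points $x_j=(j-1)h$ and spacing $h=L/M$, where $\boldsymbol\delta^{x_0}$ is the discrete delta distribution with Fourier coefficients $\hat{\boldsymbol\delta}^{x_0}_k=\frac{e^{-ikx_0}}{L}F(kh)$, $k\in K_N$. For $t\ge t_1$ define the error grid vector $\boldsymbol\varepsilon_j=\mathbf u_j(t)-u(x_j,t)$, $j=1,\dots,M$. Then for every $t\ge t_1$ there is a constant $C$, independent of $N$ (equivalently, of $h$), such that $$\|\boldsymbol\varepsilon\|_h\le C h^p,\qquad\text{where } \|\boldsymbol\varepsilon\|_h^2=\frac1L\sum_{j=1}^M h\,|\boldsymbol\varepsilon_j|^2.$$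
   Context: **Continuous problem.** Functions are $L$-periodic in $x$, and $\delta$ is understood $L$-periodically. Let $K_\infty=\{0,\pm\frac{2\pi}{L},\pm\frac{4\pi}{L},\dots\}$. Fourier coefficients are $\hat u_k=\frac1L\int_0^L e^{-ikx}u(x)\,dx$, $k\in K_\infty$; in particular $\delta(x-x_0)$ has coefficients $\frac1L e^{-ikx_0}$. The exact solution $u$ is the one whose Fourier coefficients solve $\frac{d\hat u_k}{dt}+ikc\,\hat u_k=\frac{g(t)}{L}e^{-ikv_0t}$, $\hat u_k(0)=0$, for all $k\in K_\infty$, and its point values for $t\ge t_1$ are given by its Fourier series $u(x,t)=\sum_{k\in K_\infty}\hat u_k(t)e^{ikx}$. **Grid.** For a positive integer $N$ set $M=2N+1$, $h=L/M$, $x_j=(j-1)h$, $j=1,\dots,M$. Grid vectors $\mathbf u=[\mathbf u_1,\dots,\mathbf u_M]^\top$ are indexed periodically. With $K_N=\{0,\pm\frac{2\pi}{L},\dots,\pm N\frac{2\pi}{L}\}$, every grid vector has the expansion $\mathbf u_j=\sum_{k\in K_N}\hat{\mathbf u}_k e^{ikx_j}$ with $\hat{\mathbf u}_k=\frac1L\sum_{j=1}^M h\,e^{-ikx_j}\mathbf u_j$. **Finite difference operator.** A centered finite difference operator is $(\boldsymbol\partial\mathbf u)_j=\frac1h\sum_{l=1}^r a_l(\mathbf u_{j+l}-\mathbf u_{j-l})$ with fixed real coefficients $a_l$ independent of $h$. It acts on Fourier coefficients by $\widehat{(\boldsymbol\partial \mathbf u)}_k=ik\hat P(kh)\hat{\mathbf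 u}_k$, where $\hat P(\kappa)=\frac{2}{\kappa}\sum_{l=1}^r a_l\sin(l\kappa)$ (extended continuously to $\kappa=0$) is real-valued and even. It is $p$th order accurate if $\hat P(\kappa)=1+O(\kappa^p)$ as $\kappa\to0$. It is assumed throughout that $\hat P(\kappa)$ is a strictly decreasing function of $|\kappa|$ on $[-\pi,\pi]$. **Sonic boom wavenumber.** Let $\kappa_*$ denote the smallest $\kappa\in(0,\pi]$ with $c\hat P(\kappa)=v_0$, if one exists; set $k_*=\kappa_*/h$, so $k_*h=\kappa_*$ is independent of $h$. If $\kappa_*$ exists, it is assumed to be a simple zero of $\hat P-\frac{v_0}{c}$, i.e. $\hat P'(\kappa_* )\ne0$. **Admissible source profile.** $F:\mathbb{R}\to\mathbb{R}$ is independent of $h$, bounded, even and sufficiently smooth, meaning: the restriction of $F$ to $[0,\kappa_*]$ (to $[0,\pi]$ if $\kappa_*$ does not exist) is infinitely differentiable up to and including the endpoints (one-sided derivatives). Derivatives of $F$ at the endpoints $0$ and $\kappa_*$ are one-sided derivatives of this restriction. **Moment conditions.** $F$ satisfies $m\ge1$ moment conditions if $F(0)=1$ and $F^{(\nu)}(0)=0$ for $\nu=1,\dots,m-1$. **Sonic boom conditions.** $F$ satisfies $s$ sonic boom conditions if $F^{(\nu)}(\kappa_* )=0$ for $\nu=0,\dots,s-1$ and $F(\kappa)=0$ for $\kappa>\kappa_*$. If $\kappa_*$ does not exist, these conditions are vacuous. *)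

theory Defs
  imports "HOL-Analysis.Analysis" "HOL-Library.Landau_Symbols"
begin

subsection \<open>Wavenumbers and the exact solution\<close>

definition K_inf :: "real \<Rightarrow> real set" where
  "K_inf L = (\<lambda>n::int. 2 * pi * of_int n / L) ` UNIV"

definition K_grid :: "real \<Rightarrow> nat \<Rightarrow> real set" where
  "K_grid L N = (\<lambda>n::int. 2 * pi * of_int n / L) ` {- int N..int N}"

text \<open>
  Before the time \<open>t1\<close> the solution is only used through its Fourier coefficients \<open>uh k t\<close>
  (so it may be any \<open>L\<close>-periodic distribution); from \<open>t1\<close> on, it is a function \<open>u x t\<close>
  which has these Fourier coefficients and which is the sum of its Fourier series at every point.
\<close>

definition exact_solution ::
  "real \<Rightarrow> real \<Rightarrow> real \<Rightarrow> (real \<Rightarrow> real) \<Rightarrow> real \<Rightarrow> (real \<Rightarrow> real \<Rightarrow> complex) \<Rightarrow> bool" where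
  "exact_solution L c v0 g t1 u \<longleftrightarrow>
    (\<exists>uh :: real \<Rightarrow> real \<Rightarrow> complex.
      (\<forall>k\<in>K_inf L. uh k 0 = 0 \<and>
        (\<forall>t\<ge>0. (uh k has_vector_derivative
            (of_real (g t / L) * cis (- (k * v0 * t)) - \<i> * of_real (k * c) * uh k t))
          (at t within {0..}))) \<and>
      (\<forall>t\<ge>t1.
        (\<forall>k\<in>K_inf L. ((\<lambda>x. of_real (1 / L) * cis (- (k * x)) * u x t) has_integral uh k t) {0..L}) \<and>
        (\<forall>x. ((\<lambda>k. uh k t * cis (k * x)) has_sum u x t) (K_inf L))))"

subsection \<open>Grid vectors\<close>

definition grid_size :: "nat \<Rightarrow> nat" where
  "grid_size N = 2 * N + 1"

definition grid_h :: "real \<Rightarrow> nat \<Rightarrow> real" where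
  "grid_h L N = L / of_nat (grid_size N)"

definition grid_pt :: "real \<Rightarrow> nat \<Rightarrow> int \<Rightarrow> real" where
  "grid_pt L N j = of_int (j - 1) * grid_h L N"

text \<open>Grid vectors are functions on all of \<open>int\<close> that are periodic with period \<open>M = 2 N + 1\<close>.\<close>

definition grid_vector :: "nat \<Rightarrow> (int \<Rightarrow> complex) \<Rightarrow> bool" where
  "grid_vector N w \<longleftrightarrow> (\<forall>j. w (j + int (grid_size N)) = w j)"

definition grid_coeff :: "real \<Rightarrow> nat \<Rightarrow> (int \<Rightarrow> complex) \<Rightarrow> real \<Rightarrow> complex" where
  "grid_coeff L N w k =
     of_real (1 / L) * (\<Sum>j=1..int (grid_size N). of_real (grid_h L N) * cis (- (k * grid_pt L N j)) * w j)"

definition grid_norm :: "real \<Rightarrow> nat \<Rightarrow> (int \<Rightarrow> complex) \<Rightarrow> real" where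
  "grid_norm L N w = sqrt (1 / L * (\<Sum>j=1..int (grid_size N). grid_h L N * (cmod (w j))\<^sup>2))"

text \<open>
  The discrete delta distribution is given by its Fourier expansion on the grid; that its
  Fourier coefficients are the prescribed ones is \<open>grid_coeff_discrete_delta\<close> below.
\<close>

definition discrete_delta :: "real \<Rightarrow> nat \<Rightarrow> (real \<Rightarrow> real) \<Rightarrow> real \<Rightarrow> int \<Rightarrow> complex" where
  "discrete_delta L N F x0 j =
     (\<Sum>k\<in>K_grid L N. cis (- (k * x0)) / of_real L * of_real (F (k * grid_h L N)) * cis (k * grid_pt L N j))"

subsection \<open>Centered finite difference operators\<close>

definition fd_op :: "nat \<Rightarrow> (nat \<Rightarrow> real) \<Rightarrow> real \<Rightarrow> (int \<Rightarrow> complex) \<Rightarrow> int \<Rightarrow> complex" where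
  "fd_op r a h w j = of_real (1 / h) * (\<Sum>l=1..r. of_real (a l) * (w (j + int l) - w (j - int l)))"

text \<open>The value at \<open>0\<close> is the limit; see \<open>isCont_P_hat_0\<close>.\<close>

definition P_hat :: "nat \<Rightarrow> (nat \<Rightarrow> real) \<Rightarrow> real \<Rightarrow> real" where
  "P_hat r a \<kappa> = (if \<kappa> = 0 then 2 * (\<Sum>l=1..r. a l * of_nat l)
                  else 2 / \<kappa> * (\<Sum>l=1..r. a l * sin (of_nat l * \<kappa>)))"

definition order_accurate :: "nat \<Rightarrow> (real \<Rightarrow> real) \<Rightarrow> bool" where
  "order_accurate p P \<longleftrightarrow> (\<lambda>\<kappa>. P \<kappa> - 1) \<in> O[at 0](\<lambda>\<kappa>. \<kappa> ^ p)"

definition strictly_decreasing_abs :: "(real \<Rightarrow> real) \<Rightarrow> bool" where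
  "strictly_decreasing_abs P \<longleftrightarrow>
     (\<forall>\<kappa>\<in>{-pi..pi}. \<forall>\<kappa>'\<in>{-pi..pi}. \<bar>\<kappa>\<bar> < \<bar>\<kappa>'\<bar> \<longrightarrow> P \<kappa>' < P \<kappa>)"

definition semidiscrete_solution ::
  "real \<Rightarrow> real \<Rightarrow> real \<Rightarrow> (real \<Rightarrow> real) \<Rightarrow> nat \<Rightarrow> (nat \<Rightarrow> real) \<Rightarrow> (real \<Rightarrow> real) \<Rightarrow> nat \<Rightarrow>
    (real \<Rightarrow> int \<Rightarrow> complex) \<Rightarrow> bool" where
  "semidiscrete_solution L c v0 g r a F N w \<longleftrightarrow>
     (\<forall>t\<ge>0. grid_vector N (w t)) \<and>
     (\<forall>j. w 0 j = 0) \<and>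
     (\<forall>t\<ge>0. \<forall>j. ((\<lambda>\<tau>. w \<tau> j) has_vector_derivative
         (of_real (g t) * discrete_delta L N F (v0 * t) j
           - of_real c * fd_op r a (grid_h L N) (w t) j)) (at t within {0..}))"

subsection \<open>The sonic boom wavenumber\<close>

definition sonic_exists :: "(real \<Rightarrow> real) \<Rightarrow> real \<Rightarrow> real \<Rightarrow> bool" where
  "sonic_exists P c v0 \<longleftrightarrow> (\<exists>\<kappa>. 0 < \<kappa> \<and> \<kappa> \<le> pi \<and> c * P \<kappa> = v0)"

definition kappa_star :: "(real \<Rightarrow> real) \<Rightarrow> real \<Rightarrow> real \<Rightarrow> real" where
  "kappa_star P c v0 = (LEAST \<kappa>. 0 < \<kappa> \<and> \<kappa> \<le> pi \<and> c * P \<kappa> = v0)"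

definition sonic_end :: "(real \<Rightarrow> real) \<Rightarrow> real \<Rightarrow> real \<Rightarrow> real" where
  "sonic_end P c v0 = (if sonic_exists P c v0 then kappa_star P c v0 else pi)"

subsection \<open>Source profiles\<close>

text \<open>
  \<open>deriv_within S n f\<close> is the \<open>n\<close>-th derivative of the restriction of \<open>f\<close> to \<open>S\<close>; for a
  nondegenerate closed interval \<open>S\<close> it is one-sided at the endpoints.
\<close>

definition deriv_within :: "real set \<Rightarrow> nat \<Rightarrow> (real \<Rightarrow> real) \<Rightarrow> real \<Rightarrow> real" where
  "deriv_within S n = (\<lambda>f x. vector_derivative f (at x within S)) ^^ n"

definition smooth_within :: "real set \<Rightarrow> (real \<Rightarrow> real) \<Rightarrow> bool" where
  "smooth_within S f \<longleftrightarrow> (\<forall>n. deriv_within S n f differentiable_on S)"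

definition admissible_profile :: "(real \<Rightarrow> real) \<Rightarrow> real \<Rightarrow> real \<Rightarrow> (real \<Rightarrow> real) \<Rightarrow> bool" where
  "admissible_profile P c v0 F \<longleftrightarrow>
     bounded (range F) \<and> (\<forall>\<kappa>. F (- \<kappa>) = F \<kappa>) \<and> smooth_within {0..sonic_end P c v0} F"

definition moment_conditions :: "(real \<Rightarrow> real) \<Rightarrow> real \<Rightarrow> real \<Rightarrow> nat \<Rightarrow> (real \<Rightarrow> real) \<Rightarrow> bool" where
  "moment_conditions P c v0 m F \<longleftrightarrow>
     F 0 = 1 \<and> (\<forall>\<nu>\<in>{1..<m}. deriv_within {0..sonic_end P c v0} \<nu> F 0 = 0)"

definition sonic_boom_conditions :: "(real \<Rightarrow> real) \<Rightarrow> real \<Rightarrow> real \<Rightarrow> nat \<Rightarrow> (real \<Rightarrow> real) \<Rightarrow> bool" where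
  "sonic_boom_conditions P c v0 s F \<longleftrightarrow>
     (sonic_exists P c v0 \<longrightarrow>
       (\<forall>\<nu><s. deriv_within {0..kappa_star P c v0} \<nu> F (kappa_star P c v0) = 0) \<and>
       (\<forall>\<kappa>>kappa_star P c v0. F \<kappa> = 0))"

definition times_cont_diff :: "nat \<Rightarrow> (real \<Rightarrow> real) \<Rightarrow> bool" where
  "times_cont_diff n g \<longleftrightarrow>
     (\<forall>i<n. \<forall>x. (deriv ^^ i) g differentiable (at x)) \<and> continuous_on UNIV ((deriv ^^ n) g)"

subsection \<open>Consistency of the definitions\<close>

lemma isCont_P_hat_0: "isCont (P_hat r a) 0"
proof -
  have 1: "((\<lambda>\<kappa>. sin (of_nat l * \<kappa>) / \<kappa>) \<longlongrightarrow> of_nat l) (at (0::real))" for l :: nat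
  proof -
    have "((\<lambda>\<kappa>. sin (of_nat l * \<kappa>)) has_real_derivative of_nat l) (at 0)"
      by (auto intro!: derivative_eq_intros)
    then show ?thesis by (simp add: DERIV_def)
  qed
  have "((\<lambda>\<kappa>. 2 * (\<Sum>l=1..r. a l * (sin (of_nat l * \<kappa>) / \<kappa>))) \<longlongrightarrow>
      2 * (\<Sum>l=1..r. a l * of_nat l)) (at 0)"
    by (intro tendsto_intros 1)
  moreover have "eventually (\<lambda>\<kappa>. 2 * (\<Sum>l=1..r. a l * (sin (of_nat l * \<kappa>) / \<kappa>)) = P_hat r a \<kappa>) (at 0)"
    by (auto simp: eventually_at_filter P_hat_def sum_divide_distrib[symmetric])
  ultimately have "(P_hat r a \<longlongrightarrow> 2 * (\<Sum>l=1..r. a l * of_nat l)) (at 0)"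
    by (rule Lim_transform_eventually)
  then show ?thesis by (simp add: isCont_def P_hat_def[of r a 0])
qed

lemma fd_op_mode:
  fixes N :: nat
  assumes "L > 0"
  defines "h \<equiv> grid_h L N"
  shows "fd_op r a h (\<lambda>j. cis (k * grid_pt L N j)) j
           = \<i> * of_real (k * P_hat r a (k * h)) * cis (k * grid_pt L N j)"
proof -
  have h: "h > 0" using assms by (simp add: h_def grid_h_def grid_size_def)
  have 1: "cis (k * grid_pt L N (j + int l)) - cis (k * grid_pt L N (j - int l))
      = 2 * \<i> * of_real (sin (of_nat l * (k * h))) * cis (k * grid_pt L N j)" for l
  proof -
    have e: "k * grid_pt L N (j + int l) = k * grid_pt L N j + of_nat l * (k * h)"
        "k * grid_pt L N (j - int l) = k * grid_pt L N j - of_nat l * (k * h)"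
      by (simp_all add: grid_pt_def h_def algebra_simps)
    show ?thesis unfolding e
      by (simp add: complex_eq_iff cos_add sin_add cos_diff sin_diff)
  qed
  have 2: "k * P_hat r a (k * h) = 2 / h * (\<Sum>l=1..r. a l * sin (of_nat l * (k * h)))"
    using h by (auto simp: P_hat_def field_simps)
  show ?thesis
    unfolding fd_op_def 1 2 by (simp add: sum_distrib_left sum_distrib_right algebra_simps)
qed

lemma grid_vector_discrete_delta:
  assumes "L > 0"
  shows "grid_vector N (discrete_delta L N F x0)"
proof -
  have "cis (k * grid_pt L N (j + int (grid_size N))) = cis (k * grid_pt L N j)"
    if k: "k \<in> K_grid L N" for k j
  proof -
    obtain n :: int where n: "k = 2 * pi * of_int n / L" using k unfolding K_grid_def by blast
    have "real (grid_size N) * grid_h L N = L"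
      by (simp add: grid_h_def grid_size_def del: of_nat_Suc of_nat_add)
    then have "grid_pt L N (j + int (grid_size N)) = grid_pt L N j + L"
      by (simp add: grid_pt_def algebra_simps)
    then have "k * grid_pt L N (j + int (grid_size N)) = k * grid_pt L N j + 2 * pi * of_int n"
      using assms by (simp add: n distrib_left)
    then show ?thesis by (simp add: cis_mult[symmetric] cis_multiple_2pi)
  qed
  then show ?thesis
    by (simp add: grid_vector_def discrete_delta_def)
qed

lemma sum_cis_grid:
  fixes n :: int
  assumes "L > 0" "\<bar>n\<bar> \<le> 2 * int N"
  shows "(\<Sum>j=1..int (grid_size N). cis (2 * pi * of_int n / L * grid_pt L N j))
           = (if n = 0 then of_nat (grid_size N) else 0)"
proof -
  define M where "M = grid_size N"
  have M: "M > 0" by (simp add: M_def grid_size_def)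
  define z where "z = cis (2 * pi * of_int n / of_nat M)"
  have "(\<Sum>j=1..int M. cis (2 * pi * of_int n / L * grid_pt L N j)) = (\<Sum>i<M. z ^ i)"
  proof (rule sum.reindex_bij_witness[of _ "\<lambda>i. int i + 1" "\<lambda>j. nat (j - 1)"])
    fix j assume j: "j \<in> {1..int M}"
    have "real (nat (j - 1)) * (2 * pi * of_int n / of_nat M) = 2 * pi * of_int n / L * grid_pt L N j"
      using assms j M by (simp add: grid_pt_def grid_h_def M_def[symmetric])
    then show "z ^ nat (j - 1) = cis (2 * pi * of_int n / L * grid_pt L N j)"
      unfolding z_def Complex.DeMoivre by (rule arg_cong)
  qed auto
  also have "\<dots> = (if n = 0 then of_nat M else 0)"
  proof (cases "n = 0")
    case False
    have "z \<noteq> 1"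
    proof
      assume "z = 1"
      then have "cos (2 * pi * of_int n / of_nat M) = 1" by (simp add: z_def complex_eq_iff)
      then obtain q :: int where "2 * pi * of_int n / of_nat M = of_int q * 2 * pi"
        by (auto simp: cos_one_2pi_int)
      then have "real_of_int n = of_int (q * int M)" using M by (simp add: field_simps)
      then have q: "n = q * int M" by (simp only: of_int_eq_iff)
      then have "\<bar>n\<bar> \<ge> int M" using False dvd_imp_le_int[of n "int M"] by simp
      then show False using assms(2) by (simp add: M_def grid_size_def)
    qed
    moreover have "z ^ M = 1" using M by (simp add: z_def Complex.DeMoivre cis_multiple_2pi)
    ultimately show ?thesis using False by (simp add: geometric_sum)
  qed (simp add: z_def)
  finally show ?thesis by (simp add: M_def)
qed

lemma grid_coeff_discrete_delta:
  assumes "L > 0" "k \<in> K_grid L N"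
  shows "grid_coeff L N (discrete_delta L N F x0) k
           = cis (- (k * x0)) / of_real L * of_real (F (k * grid_h L N))"
proof -
  define A where "A = (\<lambda>k. cis (- (k * x0)) / of_real L * complex_of_real (F (k * grid_h L N)))"
  have orth: "(\<Sum>j=1..int (grid_size N). cis (- (k * grid_pt L N j)) * cis (k' * grid_pt L N j))
      = (if k' = k then of_nat (grid_size N) else 0)" if k': "k' \<in> K_grid L N" for k'
  proof -
    obtain n :: int where n: "k = 2 * pi * of_int n / L" "n \<in> {- int N..int N}"
      using assms(2) unfolding K_grid_def by blast
    obtain m :: int where m: "k' = 2 * pi * of_int m / L" "m \<in> {- int N..int N}"
      using k' unfolding K_grid_def by blast
    have "cis (- (k * grid_pt L N j)) * cis (k' * grid_pt L N j)
        = cis (2 * pi * of_int (m - n) / L * grid_pt L N j)" for j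
      by (simp add: cis_mult n m algebra_simps diff_divide_distrib)
    moreover have "k' = k \<longleftrightarrow> m - n = 0" using assms(1) by (auto simp: n m)
    moreover have "\<bar>m - n\<bar> \<le> 2 * int N" using n(2) m(2) by auto
    ultimately show ?thesis using sum_cis_grid[OF assms(1), of "m - n" N] by simp
  qed
  have "grid_coeff L N (discrete_delta L N F x0) k
      = of_real (grid_h L N / L) * (\<Sum>j=1..int (grid_size N). \<Sum>k'\<in>K_grid L N.
          A k' * (cis (- (k * grid_pt L N j)) * cis (k' * grid_pt L N j)))"
    by (simp add: grid_coeff_def discrete_delta_def A_def sum_distrib_left mult_ac)
  also have "\<dots> = of_real (grid_h L N / L) * (\<Sum>k'\<in>K_grid L N. A k' *
      (\<Sum>j=1..int (grid_size N). cis (- (k * grid_pt L N j)) * cis (k' * grid_pt L N j)))"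
    by (subst sum.swap) (simp add: sum_distrib_left)
  also have "\<dots> = of_real (grid_h L N / L) * (\<Sum>k'\<in>K_grid L N. if k' = k then A k' * of_nat (grid_size N) else 0)"
    by (intro arg_cong2[where f="(*)"] refl sum.cong) (simp add: orth)
  also have "\<dots> = of_real (grid_h L N / L) * (A k * of_nat (grid_size N))"
    using assms(2) by (subst sum.delta) (auto simp: K_grid_def)
  also have "\<dots> = A k"
    using assms(1) by (simp add: grid_h_def grid_size_def field_simps del: of_nat_Suc of_nat_add)
  finally show ?thesis by (simp add: A_def)
qed

end

theory Submission
  imports Defs
begin

text \<open>
  For \<open>t \<ge> t1\<close> let \<open>G(\<omega>) = \<integral>\<^sub>0\<^sup>t g(\<tau>) e\<^bsup>i\<omega>\<tau>\<^esup> d\<tau>\<close>. Solving the two families of scalar equations, the exact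
  and the semidiscrete Fourier coefficients are \<open>e\<^bsup>-ikct\<^esup> G(k(c - v0)) / L\<close> and
  \<open>F(\<kappa>) e\<^bsup>-ikcPt\<^esup> G(k(cP - v0)) / L\<close>, where \<open>\<kappa> = kh\<close> and \<open>P\<close> is the symbol at \<open>\<kappa>\<close>. Integrating by
  parts \<open>p + 2\<close> times gives \<open>G(\<omega>) = O(|\<omega>|\<^bsup>-(p+2)\<^esup>)\<close>.
  For small \<open>\<kappa>\<close> both \<open>F - 1\<close> and \<open>P - 1\<close> are \<open>O(\<kappa>\<^sup>p)\<close>, so the coefficients differ by \<open>O(h\<^sup>p / |k|)\<close>.
  For the remaining \<open>\<kappa>\<close> each coefficient is \<open>O(|k|\<^bsup>-(p+1)\<^esup>) = O(h\<^sup>p / |k|)\<close> by itself, because the sonic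
  boom conditions give \<open>|F| = O(|cP - v0|\<^bsup>p+1\<^esup>)\<close>. As \<open>1 / |k|\<close> is square summable, Parseval's identity
  on the grid gives \<open>O(h\<^sup>p)\<close>; the modes not resolved by the grid are bounded in the maximum norm.
\<close>

subsection \<open>Oscillatory integrals\<close>

text \<open>The Fourier transform at frequency -\<omega> of \<open>f\<close> cut off to [0, t]. The
  amplitude is arbitrary because integration by parts replaces \<open>g\<close> by its
  derivatives.\<close>

definition osc_integral :: "(real \<Rightarrow> real) \<Rightarrow> real \<Rightarrow> real \<Rightarrow> complex" where
  "osc_integral f t \<omega> = integral {0..t} (\<lambda>\<tau>. of_real (f \<tau>) * cis (\<omega> * \<tau>))"

lemma has_vector_derivative_cis:
  "((\<lambda>\<tau>. cis (\<omega> * \<tau>)) has_vector_derivative (\<i> * of_real \<omega> * cis (\<omega> * x))) (at x within S)"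
  unfolding cis_conv_exp
  by (rule has_vector_derivative_eq_rhs,
      rule field_vector_diff_chain_within[where f = "\<lambda>\<tau>. \<i> * of_real (\<omega> * \<tau>)" and g = exp, unfolded o_def])
     (auto intro!: derivative_eq_intros has_vector_derivative_eq_rhs[OF has_vector_derivative_mult_right
         [OF has_vector_derivative_of_real]] DERIV_subset[OF DERIV_exp])

lemma norm_cis_diff_le: "cmod (cis x - cis y) \<le> \<bar>x - y\<bar>"
proof -
  \<comment> \<open>The factor 1 puts the function into the shape of
    \<open>has_vector_derivative_cis\<close> with frequency 1, whose derivative has modulus
    one.\<close>
  have "cmod (cis (1 * x) - cis (1 * y)) \<le> 1 * norm (x - y)"
  proof (rule differentiable_bound[of UNIV "\<lambda>\<tau>. cis (1 * \<tau>)"])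
    fix z :: real
    show "((\<lambda>\<tau>. cis (1 * \<tau>)) has_derivative (\<lambda>h. h *\<^sub>R (\<i> * of_real 1 * cis (1 * z)))) (at z within UNIV)"
      using has_vector_derivative_cis[of 1 z UNIV] unfolding has_vector_derivative_def .
    show "onorm (\<lambda>h. h *\<^sub>R (\<i> * of_real 1 * cis (1 * z))) \<le> 1"
      by (rule onorm_le) (simp add: norm_mult)
  qed auto
  then show ?thesis by simp
qed

lemma continuous_on_osc:
  assumes "continuous_on S f"
  shows "continuous_on S (\<lambda>\<tau>. complex_of_real (f \<tau>) * cis (\<omega> * \<tau>))"
  by (intro continuous_intros assms)

text \<open>The integrating factor cis(\<beta> s) removes the term in \<open>y\<close>, so the
  fundamental theorem of calculus gives the solution. Exact and semidiscrete modes are both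
  instances: \<alpha> is k v0, and \<beta> is k c or k c P.\<close>

lemma forced_oscillator_solution:
  fixes y :: "real \<Rightarrow> complex"
  assumes "t \<ge> 0" "y 0 = 0"
    and y': "\<And>s. s \<ge> 0 \<Longrightarrow> (y has_vector_derivative
      (of_real (g s) * (b * cis (- (\<alpha> * s))) - \<i> * of_real \<beta> * y s)) (at s within {0..})"
  shows "y t = b * cis (- (\<beta> * t)) * osc_integral g t (\<beta> - \<alpha>)"
proof -
  have "((\<lambda>s. b * (of_real (g s) * cis ((\<beta> - \<alpha>) * s))) has_integral
      (cis (\<beta> * t) * y t - cis (\<beta> * 0) * y 0)) {0..t}"
  proof (rule fundamental_theorem_of_calculus[OF assms(1)])
    fix s assume s: "s \<in> {0..t}"
    have d: "(y has_vector_derivative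
        (of_real (g s) * (b * cis (- (\<alpha> * s))) - \<i> * of_real \<beta> * y s)) (at s within {0..t})"
      using s by (intro has_vector_derivative_within_subset[OF y']) auto
    have "cis (\<beta> * s) * cis (- (\<alpha> * s)) = cis ((\<beta> - \<alpha>) * s)"
      by (simp add: cis_mult algebra_simps)
    then show "((\<lambda>s. cis (\<beta> * s) * y s) has_vector_derivative
        (b * (of_real (g s) * cis ((\<beta> - \<alpha>) * s)))) (at s within {0..t})"
      by (intro has_vector_derivative_eq_rhs[OF has_vector_derivative_mult[OF has_vector_derivative_cis d]])
         (simp add: algebra_simps)
  qed
  then have "integral {0..t} (\<lambda>s. b * (of_real (g s) * cis ((\<beta> - \<alpha>) * s))) = cis (\<beta> * t) * y t"
    using assms(2) by (auto dest!: integral_unique)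
  then have "b * osc_integral g t (\<beta> - \<alpha>) = cis (\<beta> * t) * y t"
    unfolding osc_integral_def integral_mult_right .
  then have "b * cis (- (\<beta> * t)) * osc_integral g t (\<beta> - \<alpha>) = (cis (- (\<beta> * t)) * cis (\<beta> * t)) * y t"
    by (simp add: algebra_simps)
  then show ?thesis by (simp add: cis_mult)
qed

text \<open>Integration by parts; the boundary terms vanish because \<open>f\<close> is zero at both
  ends.\<close>

lemma osc_integral_deriv:
  assumes "t \<ge> 0" and f': "\<And>x. (f has_real_derivative f' x) (at x)"
    and cont: "continuous_on {0..t} f'" and "f 0 = 0" "f t = 0"
  shows "osc_integral f' t \<omega> = - (\<i> * of_real \<omega>) * osc_integral f t \<omega>"
proof -
  have cf: "continuous_on {0..t} f"
    by (meson DERIV_continuous_on DERIV_subset f' subset_UNIV)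
  have "((\<lambda>s. of_real (f' s) * cis (\<omega> * s) + (\<i> * of_real \<omega>) * (of_real (f s) * cis (\<omega> * s)))
      has_integral (of_real (f t) * cis (\<omega> * t) - of_real (f 0) * cis (\<omega> * 0))) {0..t}"
  proof (rule fundamental_theorem_of_calculus[OF assms(1)])
    fix s assume s: "s \<in> {0..t}"
    have d: "((\<lambda>s. complex_of_real (f s)) has_vector_derivative of_real (f' s)) (at s within {0..t})"
      using f'[of s] by (intro has_vector_derivative_of_real)
        (metis DERIV_subset subset_UNIV has_real_derivative_iff_has_vector_derivative)
    show "((\<lambda>s. of_real (f s) * cis (\<omega> * s)) has_vector_derivative
        (of_real (f' s) * cis (\<omega> * s) + (\<i> * of_real \<omega>) * (of_real (f s) * cis (\<omega> * s)))) (at s within {0..t})"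
      by (intro has_vector_derivative_eq_rhs[OF has_vector_derivative_mult[OF d has_vector_derivative_cis]])
         (simp add: algebra_simps)
  qed
  then have "integral {0..t} (\<lambda>s. of_real (f' s) * cis (\<omega> * s) +
      (\<i> * of_real \<omega>) * (of_real (f s) * cis (\<omega> * s))) = 0"
    using assms by (simp add: integral_unique)
  moreover have "integral {0..t} (\<lambda>s. of_real (f' s) * cis (\<omega> * s) +
      (\<i> * of_real \<omega>) * (of_real (f s) * cis (\<omega> * s))) = osc_integral f' t \<omega> + (\<i> * of_real \<omega>) * osc_integral f t \<omega>"
    unfolding osc_integral_def
    by (subst Henstock_Kurzweil_Integration.integral_add)
       (auto intro!: integrable_continuous_real continuous_intros cf cont)
  ultimately show ?thesis
    by (simp add: eq_neg_iff_add_eq_0)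
qed

text \<open>The integrand is bounded by the maximum A of |f|, and a change of \<omega> alters the
  phase at time s by at most t |\<omega> - \<omega>'|. One constant covers both estimates.\<close>

lemma osc_integral_bounded_lipschitz:
  assumes "t \<ge> 0" "continuous_on {0..t} f"
  obtains B where "B \<ge> 0" "\<And>\<omega>. cmod (osc_integral f t \<omega>) \<le> B"
    "\<And>\<omega> \<omega>'. cmod (osc_integral f t \<omega> - osc_integral f t \<omega>') \<le> B * \<bar>\<omega> - \<omega>'\<bar>"
proof -
  have "bounded (f ` {0..t})"
    by (intro compact_imp_bounded compact_continuous_image assms) auto
  then obtain A where A: "A > 0" "\<And>s. s \<in> {0..t} \<Longrightarrow> \<bar>f s\<bar> \<le> A"
    unfolding bounded_pos by auto
  have 1: "cmod (osc_integral f t \<omega>) \<le> A * (t - 0)" for \<omega>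
    unfolding osc_integral_def
    by (intro integral_bound continuous_on_osc assms) (auto simp: norm_mult A)
  have 2: "cmod (osc_integral f t \<omega> - osc_integral f t \<omega>') \<le> (A * (t * \<bar>\<omega> - \<omega>'\<bar>)) * (t - 0)" for \<omega> \<omega>'
  proof -
    have "osc_integral f t \<omega> - osc_integral f t \<omega>' =
        integral {0..t} (\<lambda>s. of_real (f s) * cis (\<omega> * s) - of_real (f s) * cis (\<omega>' * s))"
      unfolding osc_integral_def
      by (intro Henstock_Kurzweil_Integration.integral_diff[symmetric] integrable_continuous_real continuous_on_osc assms)
    also have "cmod \<dots> \<le> (A * (t * \<bar>\<omega> - \<omega>'\<bar>)) * (t - 0)"
    proof (intro integral_bound continuous_intros assms)
      fix s assume s: "s \<in> {0..t}"
      have "cmod (of_real (f s) * cis (\<omega> * s) - of_real (f s) * cis (\<omega>' * s)) =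
          \<bar>f s\<bar> * cmod (cis (\<omega> * s) - cis (\<omega>' * s))"
        by (simp add: norm_mult flip: right_diff_distrib)
      also have "\<dots> \<le> A * (t * \<bar>\<omega> - \<omega>'\<bar>)"
      proof (intro mult_mono A(2)[OF s])
        have "cmod (cis (\<omega> * s) - cis (\<omega>' * s)) \<le> \<bar>\<omega> * s - \<omega>' * s\<bar>" by (rule norm_cis_diff_le)
        also have "\<dots> = s * \<bar>\<omega> - \<omega>'\<bar>" using s by (simp add: abs_mult mult.commute flip: left_diff_distrib)
        also have "\<dots> \<le> t * \<bar>\<omega> - \<omega>'\<bar>" using s by (intro mult_right_mono) auto
        finally show "cmod (cis (\<omega> * s) - cis (\<omega>' * s)) \<le> t * \<bar>\<omega> - \<omega>'\<bar>" .
      qed (use A assms in auto)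
      finally show "cmod (of_real (f s) * cis (\<omega> * s) - of_real (f s) * cis (\<omega>' * s)) \<le> A * (t * \<bar>\<omega> - \<omega>'\<bar>)" .
    qed
    finally show ?thesis .
  qed
  show thesis
  proof (rule that[of "A * t + A * t * t"])
    show "0 \<le> A * t + A * t * t" using A assms by simp
    show "cmod (osc_integral f t \<omega>) \<le> A * t + A * t * t" for \<omega>
      using 1[of \<omega>] A assms by (simp add: add_increasing2)
    show "cmod (osc_integral f t \<omega> - osc_integral f t \<omega>') \<le> (A * t + A * t * t) * \<bar>\<omega> - \<omega>'\<bar>" for \<omega> \<omega>'
      using A assms by (intro order_trans[OF 2]) (simp add: algebra_simps)
  qed
qed

text \<open>At \<open>a\<close> and \<open>b\<close> the function need not vanish on both sides. A
  derivative that exists there can be computed from the side on which the previous one is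
  zero.\<close>

lemma iterated_deriv_eq_0_outside:
  assumes "times_cont_diff n g" "\<And>t. t \<le> a \<Longrightarrow> g t = 0" "\<And>t. t \<ge> b \<Longrightarrow> g t = 0" "i \<le> n"
    and x: "x \<le> a \<or> x \<ge> b"
  shows "(deriv ^^ i) g x = 0"
  using \<open>i \<le> n\<close> x
proof (induction i arbitrary: x)
  case (Suc i)
  have "(deriv ^^ i) g differentiable (at x)"
    using assms(1) Suc.prems by (simp add: times_cont_diff_def)
  then have D: "((deriv ^^ i) g has_real_derivative (deriv ^^ Suc i) g x) (at x)"
    by (simp add: DERIV_deriv_iff_real_differentiable)
  \<comment> \<open>A nondegenerate interval with \<open>x\<close> as an end point, inside the
    region where the induction hypothesis applies.\<close>
  define S where "S = (if x \<le> a then {x - 1..x} else {x..x + 1})"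
  have S: "y \<in> S \<Longrightarrow> y \<le> a \<or> y \<ge> b" "x \<in> S" for y using Suc.prems by (auto simp: S_def split: if_splits)
  have "((\<lambda>_. 0) has_real_derivative (deriv ^^ Suc i) g x) (at x within S)"
    by (rule has_field_derivative_transform_within[OF has_field_derivative_at_within[OF D], of 1])
       (use S Suc in auto)
  moreover have "((\<lambda>_. 0) has_real_derivative 0) (at x within S)" by simp
  moreover have "at x within S \<noteq> bot"
    unfolding S_def by (auto simp: trivial_limit_within islimpt_Icc)
  ultimately show ?case
    using has_field_derivative_unique by blast
qed (use assms in auto)

lemma osc_integral_iterated_deriv:
  assumes g: "times_cont_diff n g" "\<And>t. t \<le> 0 \<Longrightarrow> g t = 0" "\<And>t. t \<ge> t1 \<Longrightarrow> g t = 0"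
    and "t \<ge> t1" "t \<ge> 0" "i \<le> n"
  shows "continuous_on {0..t} ((deriv ^^ i) g) \<and>
    osc_integral ((deriv ^^ i) g) t \<omega> = (- (\<i> * of_real \<omega>)) ^ i * osc_integral g t \<omega>"
  using \<open>i \<le> n\<close>
proof (induction i)
  \<comment> \<open>Derivatives below the top one are continuous because they are differentiable;
    for the top one continuity is part of \<open>times_cont_diff\<close>.\<close>
  have c: "continuous_on {0..t} ((deriv ^^ i) g)" if "i \<le> n" for i
  proof (cases "i = n")
    case True
    then show ?thesis using g(1) by (auto simp: times_cont_diff_def intro: continuous_on_subset)
  next
    case False
    with that have "(deriv ^^ i) g differentiable (at x)" for x
      using g(1) by (simp add: times_cont_diff_def)
    then show ?thesis
      by (intro continuous_at_imp_continuous_on) (auto intro: differentiable_imp_continuous_within)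
  qed
  {
    case 0
    show ?case using c[of 0] by simp
  next
    case (Suc i)
    have "(deriv ^^ i) g differentiable (at x)" for x
      using g(1) Suc.prems by (simp add: times_cont_diff_def)
    then have D: "((deriv ^^ i) g has_real_derivative (deriv ^^ Suc i) g x) (at x)" for x
      by (simp add: DERIV_deriv_iff_real_differentiable)
    have z: "(deriv ^^ i) g 0 = 0" "(deriv ^^ i) g t = 0"
      using iterated_deriv_eq_0_outside[of n g 0 t1 i, OF g] Suc.prems assms by auto
    show ?case
      using osc_integral_deriv[OF assms(5) D c[OF Suc.prems] z, of \<omega>] Suc c[OF Suc.prems]
      by (simp add: mult_ac)
  }
qed

text \<open>Up to a factor of modulus one, \<omega>^i G(\<omega>) is the oscillatory integral of the
  i-th derivative of \<open>g\<close>, which is bounded and Lipschitz in \<omega>.\<close>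

lemma osc_integral_decay:
  assumes g: "times_cont_diff n g" "\<And>t. t \<le> 0 \<Longrightarrow> g t = 0" "\<And>t. t \<ge> t1 \<Longrightarrow> g t = 0"
    and t: "t \<ge> t1" "t \<ge> 0" and "i \<le> n"
  obtains B where "B \<ge> 0" "\<And>\<omega>. \<bar>\<omega>\<bar> ^ i * cmod (osc_integral g t \<omega>) \<le> B"
    "\<And>\<omega> \<omega>'. cmod (of_real (\<omega> ^ i) * osc_integral g t \<omega> - of_real (\<omega>' ^ i) * osc_integral g t \<omega>') \<le> B * \<bar>\<omega> - \<omega>'\<bar>"
proof -
  note I = osc_integral_iterated_deriv[OF g t \<open>i \<le> n\<close>]
  obtain B where B: "B \<ge> 0" "\<And>\<omega>. cmod (osc_integral ((deriv ^^ i) g) t \<omega>) \<le> B"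
    "\<And>\<omega> \<omega>'. cmod (osc_integral ((deriv ^^ i) g) t \<omega> - osc_integral ((deriv ^^ i) g) t \<omega>') \<le> B * \<bar>\<omega> - \<omega>'\<bar>"
    using osc_integral_bounded_lipschitz[OF t(2)] I by metis
  have eq: "osc_integral ((deriv ^^ i) g) t \<omega> = (- \<i>) ^ i * (of_real (\<omega> ^ i) * osc_integral g t \<omega>)" for \<omega>
    using I[of \<omega>] by (simp add: power_mult_distrib flip: minus_mult_left)
      (metis (no_types, lifting) mult.assoc mult_minus_left power_mult_distrib)
  show thesis
  proof (rule that[OF B(1)])
    show "\<bar>\<omega>\<bar> ^ i * cmod (osc_integral g t \<omega>) \<le> B" for \<omega>
      using B(2)[of \<omega>] unfolding eq by (simp add: norm_mult norm_power power_abs)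
    show "cmod (of_real (\<omega> ^ i) * osc_integral g t \<omega> - of_real (\<omega>' ^ i) * osc_integral g t \<omega>') \<le> B * \<bar>\<omega> - \<omega>'\<bar>" for \<omega> \<omega>'
      using B(3)[of \<omega> \<omega>'] unfolding eq
      by (simp add: norm_mult norm_power flip: right_diff_distrib)
  qed
qed

subsection \<open>The symbol and the source profile\<close>

text \<open>Taylor's formula inside the interval, with one-sided derivatives if \<open>y\<close> is
  an end point. It is applied at 0 for the moment conditions and at the sonic boom wavenumber for
  the sonic boom conditions.\<close>

lemma smooth_within_Taylor:
  fixes F :: "real \<Rightarrow> real"
  assumes "smooth_within {0..e} F" "e > 0" "y \<in> {0..e}"
    and z: "\<And>\<nu>. 1 \<le> \<nu> \<Longrightarrow> \<nu> \<le> n \<Longrightarrow> deriv_within {0..e} \<nu> F y = 0"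
  obtains B where "B \<ge> 0" "\<And>x. x \<in> {0..e} \<Longrightarrow> \<bar>F x - F y\<bar> \<le> B * \<bar>x - y\<bar> ^ Suc n"
proof -
  let ?D = "\<lambda>i. deriv_within {0..e} i F"
  have D: "(?D i has_field_derivative ?D (Suc i) x) (at x within {0..e})" if "x \<in> {0..e}" for i x
  proof -
    have "?D i differentiable (at x within {0..e})"
      using assms(1) that by (simp add: smooth_within_def differentiable_on_def)
    then show ?thesis
      unfolding has_real_derivative_iff_has_vector_derivative
      by (simp add: vector_derivative_works deriv_within_def)
  qed
  have "continuous_on {0..e} (?D (Suc n))"
    using D DERIV_continuous_on by blast
  then have "bounded (?D (Suc n) ` {0..e})"
    by (intro compact_imp_bounded compact_continuous_image) auto
  then obtain A where A: "A > 0" "\<And>s. s \<in> {0..e} \<Longrightarrow> \<bar>?D (Suc n) s\<bar> \<le> A"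
    unfolding bounded_pos by auto
  have "\<bar>F x - F y\<bar> \<le> (A / fact n) * \<bar>x - y\<bar> ^ Suc n" if "x \<in> {0..e}" for x
  proof -
    have "norm (?D 0 x - (\<Sum>i\<le>n. ?D i y * (x - y) ^ i / fact i)) \<le> A * norm (x - y) ^ Suc n / fact n"
      by (rule field_Taylor[of "{0..e}"]) (use D A assms(3) that in auto)
    moreover have "(\<Sum>i\<le>n. ?D i y * (x - y) ^ i / fact i) = (\<Sum>i\<in>{0}. ?D i y * (x - y) ^ i / fact i)"
      by (rule sum.mono_neutral_right) (use z in auto)
    ultimately show ?thesis by (simp add: deriv_within_def)
  qed
  then show thesis using A by (intro that[of "A / fact n"]) auto
qed

section \<open>Regularity of the symbol and its sonic boom wavenumber\<close>

lemma P_hat_minus: "P_hat r a (- x) = P_hat r a x"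
  by (simp add: P_hat_def sum_negf)

lemma P_hat_abs: "P_hat r a \<bar>x\<bar> = P_hat r a x"
  by (simp add: abs_if P_hat_minus)

lemma P_hat_has_derivative:
  assumes "x \<noteq> 0"
  obtains D where "(P_hat r a has_real_derivative D) (at x)"
proof -
  have "((\<lambda>\<kappa>. 2 / \<kappa> * (\<Sum>l=1..r. a l * sin (of_nat l * \<kappa>))) has_real_derivative
      (- 2 / (x * x)) * (\<Sum>l=1..r. a l * sin (of_nat l * x)) +
      (\<Sum>l=1..r. a l * (cos (of_nat l * x) * of_nat l)) * (2 / x)) (at x)"
    using assms by (auto intro!: derivative_eq_intros simp: diff_divide_distrib mult_ac)
  then have "(P_hat r a has_real_derivative
      (- 2 / (x * x)) * (\<Sum>l=1..r. a l * sin (of_nat l * x)) +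
      (\<Sum>l=1..r. a l * (cos (of_nat l * x) * of_nat l)) * (2 / x)) (at x)"
    \<comment> \<open>The ball of radius |x| about \<open>x\<close> misses 0, where
      \<open>P_hat\<close> has a separate clause.\<close>
    by (rule has_field_derivative_transform_within[where d = "\<bar>x\<bar>"])
       (use assms in \<open>auto simp: P_hat_def dist_real_def\<close>)
  then show thesis by (rule that)
qed

lemma isCont_P_hat: "isCont (P_hat r a) x"
proof (cases "x = 0")
  case False
  then show ?thesis by (rule P_hat_has_derivative[of x r a]) (rule DERIV_isCont)
qed (simp add: isCont_P_hat_0)

text \<open>As p is positive, accuracy forces the symbol to tend to 1 at 0, and continuity makes
  this its value there.\<close>

lemma P_hat_0_eq_1:
  assumes "order_accurate p (P_hat r a)" "p \<ge> 1"
  shows "P_hat r a 0 = 1"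
proof -
  have "((\<lambda>\<kappa>::real. \<kappa> ^ p) \<longlongrightarrow> 0 ^ p) (at 0)" by (intro tendsto_intros)
  then have "((\<lambda>\<kappa>::real. \<kappa> ^ p) \<longlongrightarrow> 0) (at 0)" using assms(2) by simp
  then have "((\<lambda>\<kappa>. P_hat r a \<kappa> - 1) \<longlongrightarrow> 0) (at 0)"
    using assms(1) unfolding order_accurate_def
    by (auto elim!: landau_o.bigE intro: tendsto_0_le simp: mult.commute)
  moreover have "((\<lambda>\<kappa>. P_hat r a \<kappa> - 1) \<longlongrightarrow> P_hat r a 0 - 1) (at 0)"
    using isCont_P_hat_0 by (intro tendsto_intros) (simp add: isCont_def)
  ultimately show ?thesis using tendsto_unique[of "at (0::real)"] by fastforce
qed

text \<open>A least element of a set of reals need not exist. Here monotonicity makes the root in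
  (0, pi] unique, so \<open>LEAST\<close> returns it.\<close>

lemma kappa_star_props:
  assumes "strictly_decreasing_abs P" "sonic_exists P c v0" "c > 0"
  shows "0 < kappa_star P c v0" "kappa_star P c v0 \<le> pi" "c * P (kappa_star P c v0) = v0"
proof -
  obtain \<kappa> where \<kappa>: "0 < \<kappa>" "\<kappa> \<le> pi" "c * P \<kappa> = v0"
    using assms(2) unfolding sonic_exists_def by blast
  have uniq: "\<kappa>' = \<kappa>" if "0 < \<kappa>'" "\<kappa>' \<le> pi" "c * P \<kappa>' = v0" for \<kappa>'
  proof -
    have "P \<kappa>' = P \<kappa>" using that \<kappa> assms(3) by auto
    moreover have "P y < P x" if "0 < x" "x < y" "y \<le> pi" for x y
      using assms(1)[unfolded strictly_decreasing_abs_def, rule_format, of x y] that by auto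
    ultimately show ?thesis
      using that \<kappa> by (metis less_irrefl linorder_neqE)
  qed
  have "kappa_star P c v0 = \<kappa>"
    unfolding kappa_star_def by (intro Least_equality conjI \<kappa>) (metis uniq order_refl)
  then show "0 < kappa_star P c v0" "kappa_star P c v0 \<le> pi" "c * P (kappa_star P c v0) = v0"
    using \<kappa> by simp_all
qed

lemma continuous_pos_lower_bound:
  fixes f :: "real \<Rightarrow> real"
  assumes "continuous_on {a..b} f" "\<And>x. x \<in> {a..b} \<Longrightarrow> f x > 0"
  shows "\<exists>d>0. \<forall>x\<in>{a..b}. d \<le> f x"
proof (cases "a \<le> b")
  case True
  then obtain x where "x \<in> {a..b}" "\<forall>y\<in>{a..b}. f x \<le> f y"
    using continuous_attains_inf[of "{a..b}" f] assms(1) by auto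
  then show ?thesis using assms(2) by blast
qed (auto intro: exI[of _ 1])

text \<open>At the sonic boom wavenumber the zero of order \<open>s + 1\<close> of the profile compensates the
  simple zero of the symbol.\<close>

lemma profile_le_symbol_power:
  assumes "c > 0" "v0 < c" "p \<ge> 1" "order_accurate p (P_hat r a)"
    and dec: "strictly_decreasing_abs (P_hat r a)"
    and simple: "sonic_exists (P_hat r a) c v0 \<Longrightarrow> deriv (P_hat r a) (kappa_star (P_hat r a) c v0) \<noteq> 0"
    and adm: "admissible_profile (P_hat r a) c v0 F"
    and boom: "sonic_boom_conditions (P_hat r a) c v0 (s + 1) F"
  obtains B where "B \<ge> 0" "\<And>x. x \<in> {0..pi} \<Longrightarrow> \<bar>F x\<bar> \<le> B * \<bar>c * P_hat r a x - v0\<bar> ^ (s + 1)"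
proof (cases "sonic_exists (P_hat r a) c v0")
  case True
  define e where "e = kappa_star (P_hat r a) c v0"
  let ?P = "P_hat r a"
  note e = kappa_star_props[OF dec True assms(1), folded e_def]
  obtain D where D: "(?P has_real_derivative D) (at e)" using e(1) by (rule_tac P_hat_has_derivative[of e r a]) auto
  then have D0: "D \<noteq> 0" using simple[OF True] DERIV_imp_deriv[OF D] by (simp add: e_def)
  \<comment> \<open>The difference quotient of the symbol at \<open>e\<close>, extended
    continuously, so that P x - P e = q x (x - e). It is nonzero at \<open>e\<close> because the
    zero is simple and on [0, e) by monotonicity.\<close>
  define q where "q = (\<lambda>x. if x = e then D else (?P x - ?P e) / (x - e))"
  have "isCont q x" for x
  proof (cases "x = e")
    case True
    have "((\<lambda>x. (?P x - ?P e) / (x - e)) \<longlongrightarrow> D) (at e)"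
      using D by (simp add: has_field_derivative_iff)
    then have "(q \<longlongrightarrow> D) (at e)"
      by (rule Lim_transform_eventually) (auto simp: q_def eventually_at_filter)
    then show ?thesis by (simp add: True isCont_def) (simp add: q_def)
  next
    case False
    have "isCont (\<lambda>x. (?P x - ?P e) / (x - e)) x"
      using False by (intro continuous_intros isCont_P_hat) auto
    moreover have "eventually (\<lambda>x. x \<noteq> e) (nhds x)"
      using False by (intro t1_space_nhds)
    then have "eventually (\<lambda>x. q x = (?P x - ?P e) / (x - e)) (nhds x)"
      by eventually_elim (simp add: q_def)
    ultimately show ?thesis by (rule iffD2[OF isCont_cong, rotated])
  qed
  then have "continuous_on {0..e} (\<lambda>x. \<bar>q x\<bar>)"
    by (intro continuous_on_rabs continuous_at_imp_continuous_on) blast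
  moreover have "\<bar>q x\<bar> > 0" if "x \<in> {0..e}" for x
  proof (cases "x = e")
    case False
    then have "?P e < ?P x"
      using dec[unfolded strictly_decreasing_abs_def, rule_format, of x e] that e by auto
    then show ?thesis using False by (simp add: q_def)
  qed (simp add: q_def D0)
  ultimately have "\<exists>d>0. \<forall>x\<in>{0..e}. d \<le> \<bar>q x\<bar>"
    by (rule continuous_pos_lower_bound)
  then obtain d where d: "d > 0" "\<And>x. x \<in> {0..e} \<Longrightarrow> d \<le> \<bar>q x\<bar>"
    by blast
  \<comment> \<open>The distance to \<open>e\<close> is thus controlled by the symbol, which
    converts the Taylor bound for \<open>F\<close> at \<open>e\<close> into a bound by the
    symbol.\<close>
  have lb: "(c * d) * \<bar>x - e\<bar> \<le> \<bar>c * ?P x - v0\<bar>" if "x \<in> {0..e}" for x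
  proof -
    have "c * ?P x - v0 = c * q x * (x - e)"
      using e(3) by (auto simp: q_def field_simps)
    then have "\<bar>c * ?P x - v0\<bar> = (c * \<bar>q x\<bar>) * \<bar>x - e\<bar>" using assms(1) by (simp add: abs_mult)
    then show ?thesis using d(2)[OF that] assms(1) by (auto intro!: mult_right_mono)
  qed
  have cond: "\<And>\<nu>. \<nu> < s + 1 \<Longrightarrow> deriv_within {0..e} \<nu> F e = 0" "\<And>x. x > e \<Longrightarrow> F x = 0"
    using boom True by (auto simp: sonic_boom_conditions_def e_def)
  have Fe: "F e = 0" using cond(1)[of 0] by (simp add: deriv_within_def)
  have "smooth_within {0..e} F"
    using adm True by (simp add: admissible_profile_def sonic_end_def e_def)
  then obtain A where A: "A \<ge> 0" "\<And>x. x \<in> {0..e} \<Longrightarrow> \<bar>F x - F e\<bar> \<le> A * \<bar>x - e\<bar> ^ Suc s"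
    by (rule smooth_within_Taylor[of e F e s]) (use e(1) cond(1) in auto)
  show thesis
  proof (rule that)
    show "0 \<le> A / (c * d) ^ (s + 1)" using A d assms(1) by simp
    fix x assume x: "x \<in> {0..pi}"
    show "\<bar>F x\<bar> \<le> A / (c * d) ^ (s + 1) * \<bar>c * ?P x - v0\<bar> ^ (s + 1)"
    proof (cases "x \<le> e")
      case True
      then have x': "x \<in> {0..e}" using x by auto
      have "\<bar>F x\<bar> \<le> A * \<bar>x - e\<bar> ^ (s + 1)" using A(2)[OF x'] Fe by simp
      also have "\<dots> = A / (c * d) ^ (s + 1) * ((c * d) * \<bar>x - e\<bar>) ^ (s + 1)"
        using d assms(1) by (simp add: power_mult_distrib)
      also have "\<dots> \<le> A / (c * d) ^ (s + 1) * \<bar>c * ?P x - v0\<bar> ^ (s + 1)"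
        using A d assms(1) by (intro mult_left_mono power_mono lb x') auto
      finally show ?thesis .
    next
      case False
      then show ?thesis using cond(2)[of x] A d assms(1) by simp
    qed
  qed
next
  case False
  let ?P = "P_hat r a"
  \<comment> \<open>Without a sonic boom wavenumber, c P - v0 has no zero on [0, pi]; at 0 its value
    is c - v0 > 0. Compactness keeps it away from zero, and boundedness of \<open>F\<close>
    suffices.\<close>
  have "continuous_on {0..pi} (\<lambda>x. \<bar>c * ?P x - v0\<bar>)"
    by (intro continuous_at_imp_continuous_on ballI continuous_intros isCont_P_hat)
  moreover have "\<bar>c * ?P x - v0\<bar> > 0" if "x \<in> {0..pi}" for x
    using that False assms(2) P_hat_0_eq_1[OF assms(4,3)]
    by (cases "x = 0") (auto simp: sonic_exists_def)
  ultimately have "\<exists>d>0. \<forall>x\<in>{0..pi}. d \<le> \<bar>c * ?P x - v0\<bar>"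
    by (rule continuous_pos_lower_bound)
  then obtain d where d: "d > 0" "\<And>x. x \<in> {0..pi} \<Longrightarrow> d \<le> \<bar>c * ?P x - v0\<bar>"
    by blast
  obtain A where A: "A > 0" "\<And>x. \<bar>F x\<bar> \<le> A"
    using adm unfolding admissible_profile_def bounded_pos by auto
  show thesis
  proof (rule that)
    show "0 \<le> A / d ^ (s + 1)" using A d by simp
    fix x assume x: "x \<in> {0..pi}"
    have "\<bar>F x\<bar> \<le> A / d ^ (s + 1) * d ^ (s + 1)" using A d by simp
    also have "\<dots> \<le> A / d ^ (s + 1) * \<bar>c * ?P x - v0\<bar> ^ (s + 1)"
      using A d x by (intro mult_left_mono power_mono) auto
    finally show "\<bar>F x\<bar> \<le> A / d ^ (s + 1) * \<bar>c * ?P x - v0\<bar> ^ (s + 1)" .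
  qed
qed

text \<open>The estimates come from accuracy, from Taylor's formula with the moment conditions, and
  from continuity of the symbol. The last one keeps c P - v0 within half of c - v0 from its value at
  0, hence away from zero.\<close>

lemma near_zero_bounds:
  assumes "c > 0" "v0 < c" "p \<ge> 1" "order_accurate p (P_hat r a)"
    and dec: "strictly_decreasing_abs (P_hat r a)"
    and adm: "admissible_profile (P_hat r a) c v0 F"
    and mom: "moment_conditions (P_hat r a) c v0 p F"
  obtains A \<kappa>0 where "A \<ge> 0" "\<kappa>0 > 0"
    "\<And>x. 0 < \<bar>x\<bar> \<Longrightarrow> \<bar>x\<bar> \<le> \<kappa>0 \<Longrightarrow> \<bar>P_hat r a x - 1\<bar> \<le> A * \<bar>x\<bar> ^ p \<and> \<bar>F x - 1\<bar> \<le> A * \<bar>x\<bar> ^ p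
      \<and> c * \<bar>P_hat r a x - 1\<bar> \<le> (c - v0) / 2"
proof -
  let ?P = "P_hat r a"
  define e where "e = sonic_end ?P c v0"
  have e: "e > 0"
    using kappa_star_props(1)[OF dec _ assms(1), of v0] by (simp add: e_def sonic_end_def)
  have F: "smooth_within {0..e} F" "F 0 = 1" "\<And>\<nu>. 1 \<le> \<nu> \<Longrightarrow> \<nu> \<le> p - 1 \<Longrightarrow> deriv_within {0..e} \<nu> F 0 = 0"
    "\<And>x. F \<bar>x\<bar> = F x"
    using adm mom assms(3) by (auto simp: admissible_profile_def moment_conditions_def e_def abs_if)
  \<comment> \<open>The p - 1 vanishing derivatives give the exponent \<open>Suc (p - 1)\<close>,
    which is p.\<close>
  obtain A1 where A1: "A1 \<ge> 0" "\<And>x. x \<in> {0..e} \<Longrightarrow> \<bar>F x - F 0\<bar> \<le> A1 * \<bar>x - 0\<bar> ^ Suc (p - 1)"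
    by (rule smooth_within_Taylor[OF F(1) e, of 0 "p - 1"]) (use e F(3) in auto)
  obtain A2 where A2: "A2 > 0" "eventually (\<lambda>x. norm (?P x - 1) \<le> A2 * norm (x ^ p)) (at 0)"
    using assms(4) unfolding order_accurate_def by (rule landau_o.bigE)
  have "((\<lambda>x. c * \<bar>?P x - 1\<bar>) \<longlongrightarrow> c * \<bar>?P 0 - 1\<bar>) (at 0)"
    using isCont_P_hat_0[of r a] by (intro tendsto_intros) (simp add: isCont_def)
  then have "((\<lambda>x. c * \<bar>?P x - 1\<bar>) \<longlongrightarrow> 0) (at 0)"
    using P_hat_0_eq_1[OF assms(4,3)] by simp
  then have "eventually (\<lambda>x. c * \<bar>?P x - 1\<bar> < (c - v0) / 2) (at 0)"
    using assms(2) by (intro order_tendstoD(2)) auto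
  with A2(2) have "eventually (\<lambda>x. norm (?P x - 1) \<le> A2 * norm (x ^ p) \<and> c * \<bar>?P x - 1\<bar> < (c - v0) / 2) (at 0)"
    by eventually_elim auto
  then obtain d where d: "d > 0" "\<And>x. x \<noteq> 0 \<Longrightarrow> \<bar>x\<bar> < d \<Longrightarrow>
      norm (?P x - 1) \<le> A2 * norm (x ^ p) \<and> c * \<bar>?P x - 1\<bar> < (c - v0) / 2"
    by (auto simp: eventually_at dist_real_def)
  show thesis
  proof (rule that[of "max A1 A2" "min e (d / 2)"])
    fix x assume x: "0 < \<bar>x\<bar>" "\<bar>x\<bar> \<le> min e (d / 2)"
    have P: "\<bar>?P x - 1\<bar> \<le> A2 * \<bar>x\<bar> ^ p" "c * \<bar>?P x - 1\<bar> \<le> (c - v0) / 2"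
      using d(2)[of x] x d(1) by (auto simp: power_abs)
    \<comment> \<open>Taylor's formula covers nonnegative arguments only; evenness of
      \<open>F\<close> handles negative \<open>x\<close>.\<close>
    have "\<bar>F x - 1\<bar> \<le> A1 * \<bar>x\<bar> ^ p"
      using A1(2)[of "\<bar>x\<bar>"] x F assms(3) by simp
    moreover have "A1 * \<bar>x\<bar> ^ p \<le> max A1 A2 * \<bar>x\<bar> ^ p" "A2 * \<bar>x\<bar> ^ p \<le> max A1 A2 * \<bar>x\<bar> ^ p"
      by (intro mult_right_mono; simp)+
    ultimately show "\<bar>?P x - 1\<bar> \<le> max A1 A2 * \<bar>x\<bar> ^ p \<and> \<bar>F x - 1\<bar> \<le> max A1 A2 * \<bar>x\<bar> ^ p
      \<and> c * \<bar>?P x - 1\<bar> \<le> (c - v0) / 2"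
      using P by linarith
  qed (use A1 e d in auto)
qed

subsection \<open>The error of a single mode\<close>

lemma power_lipschitz:
  fixes R :: real
  assumes "R \<ge> 0"
  shows "\<exists>C\<ge>0. \<forall>x y. \<bar>x\<bar> \<le> R \<longrightarrow> \<bar>y\<bar> \<le> R \<longrightarrow> \<bar>x ^ m - y ^ m\<bar> \<le> C * \<bar>x - y\<bar>"
proof (induction m)
  case (Suc m)
  then obtain C where C: "C \<ge> 0" "\<And>x y. \<bar>x\<bar> \<le> R \<Longrightarrow> \<bar>y\<bar> \<le> R \<Longrightarrow> \<bar>x ^ m - y ^ m\<bar> \<le> C * \<bar>x - y\<bar>"
    by blast
  have "\<bar>x ^ Suc m - y ^ Suc m\<bar> \<le> (R * C + R ^ m) * \<bar>x - y\<bar>" if "\<bar>x\<bar> \<le> R" "\<bar>y\<bar> \<le> R" for x y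
  proof -
    have "x ^ Suc m - y ^ Suc m = x * (x ^ m - y ^ m) + y ^ m * (x - y)" by (simp add: algebra_simps)
    then have "\<bar>x ^ Suc m - y ^ Suc m\<bar> \<le> \<bar>x\<bar> * \<bar>x ^ m - y ^ m\<bar> + \<bar>y\<bar> ^ m * \<bar>x - y\<bar>"
      using abs_triangle_ineq[of "x * (x ^ m - y ^ m)" "y ^ m * (x - y)"]
      by (simp only: abs_mult power_abs)
    also have "\<dots> \<le> R * (C * \<bar>x - y\<bar>) + R ^ m * \<bar>x - y\<bar>"
      using that C assms by (intro add_mono mult_mono power_mono) auto
    finally show ?thesis by (simp add: algebra_simps)
  qed
  then show ?case using C(1) assms by (intro exI[of _ "R * C + R ^ m"]) auto
qed auto

text \<open>\<open>\<omega>\<^sup>m G(\<omega>)\<close> being Lipschitz replaces a decay estimate for the derivative of \<open>G\<close>.\<close>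

lemma decaying_difference_bound:
  fixes G :: "real \<Rightarrow> complex"
  assumes "B \<ge> 0" "d > 0" and dec: "\<And>\<omega>. \<bar>\<omega>\<bar> ^ m * cmod (G \<omega>) \<le> B"
    and lip: "\<And>\<omega> \<omega>'. cmod (of_real (\<omega> ^ m) * G \<omega> - of_real (\<omega>' ^ m) * G \<omega>') \<le> B * \<bar>\<omega> - \<omega>'\<bar>"
  obtains C where "C \<ge> 0"
    "\<And>k q q'. d \<le> q \<Longrightarrow> q \<le> R \<Longrightarrow> d \<le> q' \<Longrightarrow> q' \<le> R \<Longrightarrow>
      \<bar>k\<bar> ^ m * cmod (G (k * q) - G (k * q')) \<le> C * (\<bar>k\<bar> + 1) * \<bar>q - q'\<bar>"
proof -
  obtain L where L: "L \<ge> 0" "\<And>x y. \<bar>x\<bar> \<le> \<bar>R\<bar> \<Longrightarrow> \<bar>y\<bar> \<le> \<bar>R\<bar> \<Longrightarrow> \<bar>x ^ m - y ^ m\<bar> \<le> L * \<bar>x - y\<bar>"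
    using power_lipschitz[of "\<bar>R\<bar>" m] by auto
  \<comment> \<open>One division by d^m comes from the lower bound for q^m on the left, the inner
    one from the bound on G(k q').\<close>
  define C where "C = (B + L * B / d ^ m) / d ^ m"
  have C: "C \<ge> 0" using assms L by (simp add: C_def)
  have "\<bar>k\<bar> ^ m * cmod (G (k * q) - G (k * q')) \<le> C * (\<bar>k\<bar> + 1) * \<bar>q - q'\<bar>"
    if q: "d \<le> q" "q \<le> R" "d \<le> q'" "q' \<le> R" for k q q'
  proof -
    have Gq': "\<bar>k\<bar> ^ m * cmod (G (k * q')) \<le> B / d ^ m"
    proof -
      have "d ^ m * (\<bar>k\<bar> ^ m * cmod (G (k * q'))) \<le> q' ^ m * (\<bar>k\<bar> ^ m * cmod (G (k * q')))"
        using q assms by (intro mult_right_mono power_mono) auto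
      also have "\<dots> \<le> B" using dec[of "k * q'"] q assms by (simp add: abs_mult power_mult_distrib mult_ac)
      finally show ?thesis using assms(2) by (simp add: pos_le_divide_eq mult.commute)
    qed
    \<comment> \<open>Multiplying by (k q)^m produces the Lipschitz difference plus a correction,
      because G(k q') should carry the factor q'^m instead of q^m.\<close>
    have "of_real (q ^ m * k ^ m) * (G (k * q) - G (k * q')) =
        (of_real ((k * q) ^ m) * G (k * q) - of_real ((k * q') ^ m) * G (k * q'))
        + of_real ((q' ^ m - q ^ m) * k ^ m) * G (k * q')"
      by (simp add: algebra_simps power_mult_distrib)
    then have "cmod (of_real (q ^ m * k ^ m) * (G (k * q) - G (k * q'))) \<le>
        cmod (of_real ((k * q) ^ m) * G (k * q) - of_real ((k * q') ^ m) * G (k * q'))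
        + cmod (of_real ((q' ^ m - q ^ m) * k ^ m) * G (k * q'))"
      by (metis norm_triangle_ineq)
    also have "cmod (of_real (q ^ m * k ^ m) * (G (k * q) - G (k * q'))) =
        q ^ m * (\<bar>k\<bar> ^ m * cmod (G (k * q) - G (k * q')))"
      unfolding norm_mult norm_of_real using q assms by (simp add: abs_mult power_abs)
    also have "cmod (of_real ((q' ^ m - q ^ m) * k ^ m) * G (k * q')) =
        \<bar>q' ^ m - q ^ m\<bar> * (\<bar>k\<bar> ^ m * cmod (G (k * q')))"
      unfolding norm_mult norm_of_real by (simp add: abs_mult power_abs)
    also have "\<dots> \<le> (L * \<bar>q' - q\<bar>) * (B / d ^ m)"
      using q assms L(1) by (intro mult_mono Gq' L(2)) auto
    also have "cmod (of_real ((k * q) ^ m) * G (k * q) - of_real ((k * q') ^ m) * G (k * q')) \<le> B * \<bar>k * q - k * q'\<bar>"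
      by (rule lip)
    also have "\<bar>k * q - k * q'\<bar> = \<bar>k\<bar> * \<bar>q - q'\<bar>"
      by (simp add: abs_mult flip: right_diff_distrib)
    finally have "q ^ m * (\<bar>k\<bar> ^ m * cmod (G (k * q) - G (k * q'))) \<le>
        B * (\<bar>k\<bar> * \<bar>q - q'\<bar>) + (L * \<bar>q' - q\<bar>) * (B / d ^ m)" by simp
    also have "\<dots> \<le> (B + L * B / d ^ m) * (\<bar>k\<bar> + 1) * \<bar>q - q'\<bar>"
    proof -
      \<comment> \<open>This is exactly the difference of the two sides.\<close>
      have "0 \<le> B * \<bar>q - q'\<bar> + \<bar>k\<bar> * ((L * \<bar>q' - q\<bar>) * (B / d ^ m))"
        using assms L by simp
      then show ?thesis by (simp add: algebra_simps add_divide_distrib abs_minus_commute)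
    qed
    finally have "d ^ m * (\<bar>k\<bar> ^ m * cmod (G (k * q) - G (k * q'))) \<le> (B + L * B / d ^ m) * (\<bar>k\<bar> + 1) * \<bar>q - q'\<bar>"
      using q assms by (intro order_trans[OF mult_right_mono[OF power_mono[of d q]]]) auto
    then show ?thesis using assms(2) by (simp add: C_def pos_le_divide_eq mult.commute)
  qed
  then show thesis using C that by blast
qed

text \<open>The constant must be uniform in \<open>k\<close> and \<open>h\<close>, so the cases are
  separated at a fixed value of |k h|. Below it, the phase error and the frequency shift cost a
  factor |k|, which decay of order p + 2 can afford. Above it, decay of order p + 1 is paired with
  the matching power of c P - v0 in the bound on \<open>F\<close>.\<close>

lemma mode_error_bound:
  assumes "p \<ge> 1" "c > 0" "v0 < c" "t1 > 0" "k0 > 0" "t \<ge> t1"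
    and ord: "order_accurate p (P_hat r a)"
    and dec: "strictly_decreasing_abs (P_hat r a)"
    and simple: "sonic_exists (P_hat r a) c v0 \<Longrightarrow> deriv (P_hat r a) (kappa_star (P_hat r a) c v0) \<noteq> 0"
    and g: "times_cont_diff (p + 2) g" "\<And>t. t \<le> 0 \<Longrightarrow> g t = 0" "\<And>t. t \<ge> t1 \<Longrightarrow> g t = 0"
    and adm: "admissible_profile (P_hat r a) c v0 F"
    and mom: "moment_conditions (P_hat r a) c v0 p F"
    and boom: "sonic_boom_conditions (P_hat r a) c v0 (p + 1) F"
  defines "G \<equiv> osc_integral g t"
  obtains C where "C \<ge> 0"
    "\<And>k h. h > 0 \<Longrightarrow> \<bar>k\<bar> \<ge> k0 \<Longrightarrow> \<bar>k * h\<bar> \<le> pi \<Longrightarrow>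
      cmod (of_real (F (k * h)) * cis (- (k * c * P_hat r a (k * h) * t)) * G (k * (c * P_hat r a (k * h) - v0))
        - cis (- (k * c * t)) * G (k * (c - v0))) \<le> C * h ^ p / \<bar>k\<bar>"
proof -
  let ?P = "P_hat r a"
  have t: "t \<ge> 0" using assms by simp
  obtain B where B: "B \<ge> 0" "\<And>\<omega>. \<bar>\<omega>\<bar> ^ (p + 2) * cmod (G \<omega>) \<le> B"
    "\<And>\<omega> \<omega>'. cmod (of_real (\<omega> ^ (p + 2)) * G \<omega> - of_real (\<omega>' ^ (p + 2)) * G \<omega>') \<le> B * \<bar>\<omega> - \<omega>'\<bar>"
    unfolding G_def by (rule osc_integral_decay[OF g \<open>t \<ge> t1\<close> t, of "p + 2"]) auto
  obtain B' where B': "B' \<ge> 0" "\<And>\<omega>. \<bar>\<omega>\<bar> ^ (p + 1) * cmod (G \<omega>) \<le> B'"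
    unfolding G_def by (rule osc_integral_decay[OF g \<open>t \<ge> t1\<close> t, of "p + 1"]) auto
  obtain S where S: "S \<ge> 0" "\<And>x. x \<in> {0..pi} \<Longrightarrow> \<bar>F x\<bar> \<le> S * \<bar>c * ?P x - v0\<bar> ^ (p + 1)"
    using profile_le_symbol_power[OF assms(2,3,1) ord dec simple adm boom] by blast
  obtain A \<kappa>0 where A: "A \<ge> 0" "\<kappa>0 > 0"
    "\<And>x. 0 < \<bar>x\<bar> \<Longrightarrow> \<bar>x\<bar> \<le> \<kappa>0 \<Longrightarrow> \<bar>?P x - 1\<bar> \<le> A * \<bar>x\<bar> ^ p \<and> \<bar>F x - 1\<bar> \<le> A * \<bar>x\<bar> ^ p
      \<and> c * \<bar>?P x - 1\<bar> \<le> (c - v0) / 2"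
    using near_zero_bounds[OF assms(2,3,1) ord dec adm mom] by blast
  \<comment> \<open>The exact frequency factor c - v0 is then 2 d, and near zero the discrete one
    stays in [d, 3 d].\<close>
  define d where "d = (c - v0) / 2"
  have d: "d > 0" using assms by (simp add: d_def)
  obtain D where D: "D \<ge> 0" "\<And>k q q'. d \<le> q \<Longrightarrow> q \<le> 3 * d \<Longrightarrow> d \<le> q' \<Longrightarrow> q' \<le> 3 * d \<Longrightarrow>
      \<bar>k\<bar> ^ (p + 2) * cmod (G (k * q) - G (k * q')) \<le> D * (\<bar>k\<bar> + 1) * \<bar>q - q'\<bar>"
    using decaying_difference_bound[OF B(1) d B(2,3), where R = "3 * d"] by blast
  define B1 where "B1 = B / d ^ (p + 2)"
  have B1: "B1 \<ge> 0" using B d by (simp add: B1_def)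
  \<comment> \<open>The three terms belong to the profile, the phase and the frequency;
    \<open>K2\<close> adds the separate bounds for the discrete and the exact coefficient.\<close>
  define K1 where "K1 = A * B1 / k0 + c * t * A * B1 + D * (1 + 1 / k0) * (c * A)"
  have K1: "K1 \<ge> 0" using A B1 D assms t by (simp add: K1_def)
  define K2 where "K2 = S * B' + B' / (2 * d) ^ (p + 1)"
  have K2: "K2 \<ge> 0" using S B' d by (simp add: K2_def)
  show thesis
  proof (rule that)
    show "0 \<le> K1 + K2 / \<kappa>0 ^ p" using K1 K2 A by simp
    fix k h :: real assume h: "h > 0" and k: "\<bar>k\<bar> \<ge> k0" and x: "\<bar>k * h\<bar> \<le> pi"
    have k_pos: "\<bar>k\<bar> > 0" using k assms by linarith
    define x where "x = k * h"
    define q where "q = c * ?P x - v0"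
    define e1 where "e1 = cis (- (k * c * ?P x * t))"
    define e2 where "e2 = cis (- (k * c * t))"
    define E where "E = of_real (F x) * e1 * G (k * q) - e2 * G (k * (2 * d))"
    have x_pos: "\<bar>x\<bar> > 0" using k_pos h by (simp add: x_def)
    have absx: "\<bar>x\<bar> = \<bar>k\<bar> * h" using h by (simp add: x_def abs_mult)
    have "cmod E \<le> (K1 + K2 / \<kappa>0 ^ p) * h ^ p / \<bar>k\<bar>"
    proof (cases "\<bar>x\<bar> \<le> \<kappa>0")
      case True
      note near = A(3)[OF x_pos True]
      have qq: "\<bar>q - 2 * d\<bar> = c * \<bar>?P x - 1\<bar>"
      proof -
        have "q - 2 * d = c * (?P x - 1)" by (simp add: q_def d_def field_simps)
        then show ?thesis using assms(2) by (simp add: abs_mult)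
      qed
      then have "\<bar>q - 2 * d\<bar> \<le> d" using near by (simp add: d_def)
      then have q: "d \<le> q" "q \<le> 3 * d" by auto
      have Gq: "\<bar>k\<bar> ^ (p + 2) * cmod (G (k * q)) \<le> B1"
      proof -
        have "d ^ (p + 2) * (\<bar>k\<bar> ^ (p + 2) * cmod (G (k * q))) \<le> q ^ (p + 2) * (\<bar>k\<bar> ^ (p + 2) * cmod (G (k * q)))"
          using q d by (intro mult_right_mono power_mono) auto
        also have "\<dots> = \<bar>k * q\<bar> ^ (p + 2) * cmod (G (k * q))"
          using q d by (simp only: abs_mult power_mult_distrib) simp
        also have "\<dots> \<le> B" by (rule B(2))
        finally show ?thesis using d unfolding B1_def by (subst pos_le_divide_eq) (auto simp: mult.commute)
      qed
      have e12: "cmod (e1 - e2) \<le> \<bar>k\<bar> * c * t * (A * \<bar>x\<bar> ^ p)"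
      proof -
        have "cmod (e1 - e2) \<le> \<bar>- (k * c * ?P x * t) - - (k * c * t)\<bar>"
          unfolding e1_def e2_def by (rule norm_cis_diff_le)
        also have "- (k * c * ?P x * t) - - (k * c * t) = - (k * c * t * (?P x - 1))"
          by (simp add: algebra_simps)
        also have "\<bar>\<dots>\<bar> = \<bar>k\<bar> * c * t * \<bar>?P x - 1\<bar>"
          using assms(2) t by (simp add: abs_mult)
        also have "\<dots> \<le> \<bar>k\<bar> * c * t * (A * \<bar>x\<bar> ^ p)"
          using near assms(2) t by (intro mult_left_mono) auto
        finally show ?thesis .
      qed
      \<comment> \<open>Profile, phase and frequency are changed one at a time.\<close>
      have "E = of_real (F x - 1) * e1 * G (k * q) + (e1 - e2) * G (k * q) + e2 * (G (k * q) - G (k * (2 * d)))"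
        by (simp add: E_def algebra_simps)
      then have "cmod E \<le> cmod (of_real (F x - 1) * e1 * G (k * q)) + cmod ((e1 - e2) * G (k * q))
          + cmod (e2 * (G (k * q) - G (k * (2 * d))))"
        by (metis norm_triangle_mono norm_triangle_ineq order_refl)
      also have "\<dots> = \<bar>F x - 1\<bar> * cmod (G (k * q)) + cmod (e1 - e2) * cmod (G (k * q))
          + cmod (G (k * q) - G (k * (2 * d)))"
        unfolding norm_mult norm_of_real by (simp add: e1_def e2_def)
      finally have "\<bar>k\<bar> ^ (p + 2) * cmod E \<le> \<bar>k\<bar> ^ (p + 2) * (\<bar>F x - 1\<bar> * cmod (G (k * q)) + cmod (e1 - e2) * cmod (G (k * q))
          + cmod (G (k * q) - G (k * (2 * d))))"
        by (rule mult_left_mono) simp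
      also have "\<dots> = \<bar>F x - 1\<bar> * (\<bar>k\<bar> ^ (p + 2) * cmod (G (k * q))) + cmod (e1 - e2) * (\<bar>k\<bar> ^ (p + 2) * cmod (G (k * q)))
          + \<bar>k\<bar> ^ (p + 2) * cmod (G (k * q) - G (k * (2 * d)))"
        by (simp only: distrib_left mult_ac)
      also have "\<dots> \<le> (A * \<bar>x\<bar> ^ p) * B1 + (\<bar>k\<bar> * c * t * (A * \<bar>x\<bar> ^ p)) * B1 + D * (\<bar>k\<bar> + 1) * (c * (A * \<bar>x\<bar> ^ p))"
      proof (intro add_mono)
        show "\<bar>F x - 1\<bar> * (\<bar>k\<bar> ^ (p + 2) * cmod (G (k * q))) \<le> (A * \<bar>x\<bar> ^ p) * B1"
          using near A B1 by (intro mult_mono Gq) auto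
        show "cmod (e1 - e2) * (\<bar>k\<bar> ^ (p + 2) * cmod (G (k * q))) \<le> (\<bar>k\<bar> * c * t * (A * \<bar>x\<bar> ^ p)) * B1"
          using A B1 assms(2) t by (intro mult_mono Gq e12) auto
        have "\<bar>k\<bar> ^ (p + 2) * cmod (G (k * q) - G (k * (2 * d))) \<le> D * (\<bar>k\<bar> + 1) * \<bar>q - 2 * d\<bar>"
          using q d by (intro D(2)) auto
        also have "\<dots> \<le> D * (\<bar>k\<bar> + 1) * (c * (A * \<bar>x\<bar> ^ p))"
          unfolding qq using near assms(2) D by (intro mult_left_mono) auto
        finally show "\<bar>k\<bar> ^ (p + 2) * cmod (G (k * q) - G (k * (2 * d))) \<le> D * (\<bar>k\<bar> + 1) * (c * (A * \<bar>x\<bar> ^ p))" .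
      qed
      also have "\<dots> = \<bar>x\<bar> ^ p * (A * B1 * 1 + \<bar>k\<bar> * (c * t * A * B1) + D * (\<bar>k\<bar> + 1) * (c * A))"
        by (simp add: algebra_simps)
      \<comment> \<open>From |k| \<ge> k0 it follows that 1 \<le> |k| / k0, so all terms acquire a
        common factor |k|.\<close>
      also have "\<dots> \<le> \<bar>x\<bar> ^ p * (A * B1 * (\<bar>k\<bar> / k0) + \<bar>k\<bar> * (c * t * A * B1) + D * (\<bar>k\<bar> + \<bar>k\<bar> / k0) * (c * A))"
        using k assms A B1 D t
        by (intro mult_left_mono add_mono mult_right_mono) (auto simp: pos_le_divide_eq)
      also have "\<dots> = \<bar>x\<bar> ^ p * \<bar>k\<bar> * K1"
        by (simp add: K1_def algebra_simps)
      \<comment> \<open>Since |x| = |k| h, there are p + 1 powers of |k| on the left; dividing by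
        |k|^(p + 2) leaves h^p / |k|.\<close>
      also have "\<dots> = \<bar>k\<bar> ^ (p + 2) * (K1 * h ^ p / \<bar>k\<bar>)"
        using k_pos by (simp add: absx power_mult_distrib)
      finally have "cmod E \<le> K1 * h ^ p / \<bar>k\<bar>"
        using k_pos by (metis mult_le_cancel_left_pos zero_less_power)
      also have "\<dots> \<le> (K1 + K2 / \<kappa>0 ^ p) * h ^ p / \<bar>k\<bar>"
        using K2 A h by (intro divide_right_mono mult_right_mono) auto
      finally show ?thesis .
    next
      case False
      have ev: "F \<bar>x\<bar> = F x" using adm by (auto simp: admissible_profile_def abs_if)
      have Fx: "\<bar>F x\<bar> \<le> S * \<bar>q\<bar> ^ (p + 1)"
        using S(2)[of "\<bar>x\<bar>"] x by (simp add: ev[unfolded x_def] P_hat_abs q_def x_def)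
      have "cmod E \<le> cmod (of_real (F x) * e1 * G (k * q)) + cmod (e2 * G (k * (2 * d)))"
        unfolding E_def by (rule norm_triangle_ineq4)
      also have "\<dots> = \<bar>F x\<bar> * cmod (G (k * q)) + cmod (G (k * (2 * d)))"
        unfolding norm_mult norm_of_real by (simp add: e1_def e2_def)
      finally have "\<bar>k\<bar> ^ (p + 1) * cmod E \<le> \<bar>k\<bar> ^ (p + 1) * (\<bar>F x\<bar> * cmod (G (k * q)) + cmod (G (k * (2 * d))))"
        by (rule mult_left_mono) simp
      \<comment> \<open>The factor |q|^(p + 1) completes |k|^(p + 1) to |k q|^(p + 1), so the decay
        estimate for G(k q) remains useful when q is close to zero.\<close>
      also have "\<dots> \<le> \<bar>k\<bar> ^ (p + 1) * (S * \<bar>q\<bar> ^ (p + 1) * cmod (G (k * q)) + cmod (G (k * (2 * d))))"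
        by (intro mult_left_mono add_mono mult_right_mono Fx) auto
      also have "\<dots> = S * (\<bar>k * q\<bar> ^ (p + 1) * cmod (G (k * q)))
          + (\<bar>k * (2 * d)\<bar> ^ (p + 1) * cmod (G (k * (2 * d)))) / (2 * d) ^ (p + 1)"
      proof -
        have "\<bar>k * (2 * d)\<bar> ^ (p + 1) = \<bar>k\<bar> ^ (p + 1) * (2 * d) ^ (p + 1)"
          using d by (simp add: abs_mult power_mult_distrib)
        moreover have "\<bar>k * q\<bar> ^ (p + 1) = \<bar>k\<bar> ^ (p + 1) * \<bar>q\<bar> ^ (p + 1)"
          by (simp only: abs_mult power_mult_distrib)
        ultimately show ?thesis using d by (simp add: distrib_left mult_ac)
      qed
      also have "\<dots> \<le> S * B' + B' / (2 * d) ^ (p + 1)"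
        using S(1) d by (intro add_mono mult_left_mono divide_right_mono B') auto
      finally have "\<bar>k\<bar> ^ (p + 1) * cmod E \<le> K2" by (simp add: K2_def)
      then have "\<bar>k\<bar> ^ p * (\<bar>k\<bar> * cmod E) \<le> K2" by (simp add: mult_ac)
      \<comment> \<open>In this case |k| > \<kappa>0 / h, which trades p powers of |k| for
        h^p.\<close>
      moreover have "(\<kappa>0 / h) ^ p * (\<bar>k\<bar> * cmod E) \<le> \<bar>k\<bar> ^ p * (\<bar>k\<bar> * cmod E)"
        using False h A by (intro mult_right_mono power_mono) (auto simp: absx pos_divide_le_eq)
      ultimately have "(\<kappa>0 / h) ^ p * (\<bar>k\<bar> * cmod E) \<le> K2" by linarith
      then have "cmod E \<le> K2 / \<kappa>0 ^ p * h ^ p / \<bar>k\<bar>"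
        using h A k_pos by (simp add: power_divide field_simps)
      also have "\<dots> \<le> (K1 + K2 / \<kappa>0 ^ p) * h ^ p / \<bar>k\<bar>"
        using K1 h by (intro divide_right_mono mult_right_mono) auto
      finally show ?thesis .
    qed
    moreover have "c - v0 = 2 * d" by (simp add: d_def)
    ultimately show "cmod (of_real (F (k * h)) * cis (- (k * c * ?P (k * h) * t)) * G (k * (c * ?P (k * h) - v0))
        - cis (- (k * c * t)) * G (k * (c - v0))) \<le> (K1 + K2 / \<kappa>0 ^ p) * h ^ p / \<bar>k\<bar>"
      by (simp only: E_def e1_def e2_def q_def x_def)
  qed
qed

subsection \<open>Fourier analysis on the grid\<close>

lemma finite_K_grid [simp]: "finite (K_grid L N)"
  by (simp add: K_grid_def)

lemma K_grid_subset_K_inf: "K_grid L N \<subseteq> K_inf L"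
  by (auto simp: K_grid_def K_inf_def)

lemma K_inf_abs_ge:
  assumes "L > 0" "k \<in> K_inf L" "k \<noteq> 0"
  shows "\<bar>k\<bar> \<ge> 2 * pi / L"
proof -
  obtain n :: int where n: "k = 2 * pi * of_int n / L" using assms(2) by (auto simp: K_inf_def)
  with assms have "\<bar>of_int n\<bar> \<ge> (1::real)" by (cases "n = 0") (auto simp flip: of_int_abs)
  then have "2 * pi * 1 / L \<le> 2 * pi * \<bar>of_int n\<bar> / L"
    using assms by (intro divide_right_mono mult_left_mono) auto
  then show ?thesis using assms by (simp add: n abs_mult)
qed

lemma K_grid_abs_le:
  assumes "L > 0" "k \<in> K_grid L N"
  shows "\<bar>k * grid_h L N\<bar> \<le> pi"
proof -
  obtain n :: int where n: "k = 2 * pi * of_int n / L" "n \<in> {- int N..int N}"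
    using assms(2) unfolding K_grid_def by blast
  have n': "\<bar>of_int n\<bar> \<le> real N" using n(2) by auto
  have "\<bar>k * grid_h L N\<bar> = pi * (2 * \<bar>of_int n\<bar>) / (2 * real N + 1)"
    using assms by (simp add: n grid_h_def grid_size_def abs_mult ac_simps)
  also have "\<dots> \<le> pi * (2 * real N + 1) / (2 * real N + 1)"
    using n' by (intro divide_right_mono mult_left_mono) auto
  finally show ?thesis by simp
qed

lemma off_grid_abs_ge:
  assumes "L > 0" "k \<in> K_inf L - K_grid L N"
  shows "\<bar>k * grid_h L N\<bar> \<ge> pi"
proof -
  obtain n :: int where n: "k = 2 * pi * of_int n / L" using assms(2) by (auto simp: K_inf_def)
  then have "\<bar>n\<bar> > int N" using assms by (force simp: K_grid_def)
  then have n': "\<bar>of_int n\<bar> \<ge> real N + 1" by linarith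
  have "pi * (2 * real N + 1) / (2 * real N + 1) \<le> pi * (2 * \<bar>of_int n\<bar>) / (2 * real N + 1)"
    using n' by (intro divide_right_mono mult_left_mono) auto
  also have "\<dots> = \<bar>k * grid_h L N\<bar>"
    using assms by (simp add: n grid_h_def grid_size_def abs_mult ac_simps)
  finally show ?thesis by simp
qed

lemma sum_inverse_squares_K_inf:
  assumes "L > 0"
  shows "\<exists>S\<ge>0. \<forall>A. finite A \<and> A \<subseteq> K_inf L - {0} \<longrightarrow> (\<Sum>k\<in>A. 1 / k\<^sup>2) \<le> S"
proof -
  \<comment> \<open>The term at n = 0 is 1 / 0 = 0, so it adds nothing.\<close>
  have sm: "summable (\<lambda>n. 1 / real n ^ 2)"
    using inverse_power_summable[of 2] by (simp add: divide_inverse)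
  define Z where "Z = (\<Sum>n. 1 / real n ^ 2)"
  have Z: "sum (\<lambda>n. 1 / real n ^ 2) I \<le> Z" if "finite I" for I
    unfolding Z_def by (intro sum_le_suminf sm that) auto
  have J: "(\<Sum>n\<in>J. 1 / (of_int n)\<^sup>2) \<le> 2 * Z" if "finite J" for J :: "int set"
  proof -
    \<comment> \<open>The absolute value is injective on the nonnegative and on the negative
      integers separately, hence the factor 2 below.\<close>
    have 1: "(\<Sum>n\<in>I. 1 / (of_int n)\<^sup>2) \<le> Z" if "finite I" "inj_on (\<lambda>n. nat \<bar>n\<bar>) I" for I :: "int set"
    proof -
      have "(\<Sum>n\<in>I. 1 / (of_int n)\<^sup>2) = (\<Sum>m\<in>(\<lambda>n. nat \<bar>n\<bar>) ` I. 1 / real m ^ 2)"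
        by (simp add: sum.reindex[OF that(2)])
      also have "\<dots> \<le> Z" using that by (intro Z) auto
      finally show ?thesis .
    qed
    have "(\<Sum>n\<in>J. 1 / (of_int n)\<^sup>2) = (\<Sum>n\<in>J \<inter> {0..}. 1 / (of_int n)\<^sup>2) + (\<Sum>n\<in>J \<inter> {..<0}. 1 / (real_of_int n)\<^sup>2)"
      using that by (subst sum.union_disjoint[symmetric]) (auto intro!: sum.cong)
    also have "\<dots> \<le> Z + Z"
      using that by (intro add_mono 1) (auto simp: inj_on_def)
    finally show ?thesis by simp
  qed
  show ?thesis
  proof (intro exI conjI allI impI)
    show "0 \<le> (L / (2 * pi))\<^sup>2 * (2 * Z)" using Z[of "{}"] by simp
    fix A assume A: "finite A \<and> A \<subseteq> K_inf L - {0}"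
    define \<phi> where "\<phi> = (\<lambda>n::int. 2 * pi * of_int n / L)"
    have inj: "inj \<phi>" using assms by (auto simp: inj_def \<phi>_def)
    define J where "J = \<phi> -` A"
    have JA: "A = \<phi> ` J" using A by (auto simp: J_def K_inf_def \<phi>_def)
    have "finite J" unfolding J_def using A inj by (intro finite_vimageI) auto
    have "(\<Sum>k\<in>A. 1 / k\<^sup>2) = (\<Sum>n\<in>J. 1 / (\<phi> n)\<^sup>2)"
      unfolding JA using inj by (subst sum.reindex) (auto intro: inj_on_subset)
    also have "\<dots> = (L / (2 * pi))\<^sup>2 * (\<Sum>n\<in>J. 1 / (of_int n)\<^sup>2)"
      by (simp add: \<phi>_def sum_distrib_left power_divide power_mult_distrib)
    also have "\<dots> \<le> (L / (2 * pi))\<^sup>2 * (2 * Z)"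
      by (intro mult_left_mono J \<open>finite J\<close>) auto
    finally show "(\<Sum>k\<in>A. 1 / k\<^sup>2) \<le> (L / (2 * pi))\<^sup>2 * (2 * Z)" .
  qed
qed

text \<open>A bound on the finite partial sums passes to the limit; this controls the part of the
  Fourier series not resolved by the grid.\<close>

lemma norm_has_sum_le:
  fixes f :: "'a \<Rightarrow> 'b::real_normed_vector"
  assumes "(f has_sum s) A" "\<And>F. finite F \<Longrightarrow> F \<subseteq> A \<Longrightarrow> (\<Sum>x\<in>F. norm (f x)) \<le> T"
  shows "norm s \<le> T"
proof (rule Lim_norm_ubound)
  show "(sum f \<longlongrightarrow> s) (finite_subsets_at_top A)" using assms(1) by (simp add: has_sum_def)
  show "eventually (\<lambda>F. norm (sum f F) \<le> T) (finite_subsets_at_top A)"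
    by (intro eventually_finite_subsets_at_top_weakI order_trans[OF norm_sum assms(2)])
qed simp

section \<open>Discrete Fourier coefficients and Parseval's identity\<close>

lemma grid_coeff_sum: "grid_coeff L N (\<lambda>j. \<Sum>i\<in>I. f i j) k = (\<Sum>i\<in>I. grid_coeff L N (f i) k)"
  unfolding grid_coeff_def by (simp add: sum_distrib_left sum.swap[of _ I])

lemma grid_coeff_cmult: "grid_coeff L N (\<lambda>j. b * w j) k = b * grid_coeff L N w k"
  by (simp add: grid_coeff_def sum_distrib_left mult_ac)

lemma grid_coeff_diff: "grid_coeff L N (\<lambda>j. v j - w j) k = grid_coeff L N v k - grid_coeff L N w k"
  by (simp add: grid_coeff_def sum_subtractf right_diff_distrib)

text \<open>A single mode is the discrete delta distribution of a profile supported at one wavenumber.\<close>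

lemma grid_coeff_mode:
  assumes "L > 0" "k \<in> K_grid L N" "k' \<in> K_grid L N"
  shows "grid_coeff L N (\<lambda>j. cis (k' * grid_pt L N j)) k = (if k = k' then 1 else 0)"
proof -
  \<comment> \<open>The value \<open>L\<close> cancels the factor 1 / L of the delta distribution,
    and the source position 0 makes its phase factor 1.\<close>
  define F where "F = (\<lambda>\<kappa>. if \<kappa> = k' * grid_h L N then L else 0)"
  have h: "grid_h L N \<noteq> 0" using assms(1) by (simp add: grid_h_def grid_size_def)
  have F: "of_real (F (\<kappa> * grid_h L N)) = (if \<kappa> = k' then of_real L else (0::complex))" for \<kappa>
    using h by (simp add: F_def)
  have "discrete_delta L N F 0 = (\<lambda>j. cis (k' * grid_pt L N j))"
  proof
    fix j
    have "discrete_delta L N F 0 j = (\<Sum>\<kappa>\<in>K_grid L N. if \<kappa> = k' then cis (\<kappa> * grid_pt L N j) else 0)"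
      unfolding discrete_delta_def F using assms(1) by (intro sum.cong) auto
    also have "\<dots> = cis (k' * grid_pt L N j)"
      using assms(3) by (subst sum.delta) auto
    finally show "discrete_delta L N F 0 j = cis (k' * grid_pt L N j)" .
  qed
  then show ?thesis
    using grid_coeff_discrete_delta[OF assms(1,2), of F 0] assms(1) F by simp
qed

lemma grid_coeff_expansion:
  assumes "L > 0" "k \<in> K_grid L N"
  shows "grid_coeff L N (\<lambda>j. \<Sum>k'\<in>K_grid L N. A k' * cis (k' * grid_pt L N j)) k = A k"
proof -
  have "grid_coeff L N (\<lambda>j. \<Sum>k'\<in>K_grid L N. A k' * cis (k' * grid_pt L N j)) k
      = (\<Sum>k'\<in>K_grid L N. A k' * (if k = k' then 1 else 0))"
    by (simp add: grid_coeff_sum grid_coeff_cmult grid_coeff_mode[OF assms])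
  also have "\<dots> = (\<Sum>k'\<in>K_grid L N. if k = k' then A k' else 0)"
    by (intro sum.cong) auto
  finally show ?thesis using assms(2) by (simp add: sum.delta')
qed

text \<open>The dual orthogonality relation. Wavenumber index and grid index enter the phase
  symmetrically, so exchanging them reduces it to \<open>sum_cis_grid\<close> with j - i as
  frequency; |j - i| \<le> 2 N as required there.\<close>

lemma sum_cis_wavenumbers:
  assumes "L > 0" "i \<in> {1..int (grid_size N)}" "j \<in> {1..int (grid_size N)}"
  shows "(\<Sum>k\<in>K_grid L N. cis (k * (grid_pt L N j - grid_pt L N i)))
           = (if i = j then of_nat (grid_size N) else 0)"
proof -
  define M where "M = grid_size N"
  have M: "M > 0" "M = 2 * N + 1" by (simp_all add: M_def grid_size_def)
  have "(\<Sum>k\<in>K_grid L N. cis (k * (grid_pt L N j - grid_pt L N i)))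
      = (\<Sum>n=-int N..int N. cis (2 * pi * of_int n / L * (grid_pt L N j - grid_pt L N i)))"
    unfolding K_grid_def using assms(1) by (subst sum.reindex) (auto simp: inj_on_def)
  also have "\<dots> = (\<Sum>m=1..int M. cis (- (2 * pi * real N * of_int (j - i) / real M))
      * cis (2 * pi * of_int (j - i) / L * grid_pt L N m))"
  \<comment> \<open>Shifting -N..N to 1..M costs a constant phase, which factors out of the
    sum.\<close>
  proof (rule sum.reindex_bij_witness[of _ "\<lambda>m. m - 1 - int N" "\<lambda>n. n + 1 + int N"])
    fix n assume "n \<in> {- int N..int N}"
    have "2 * pi * of_int n / L * (grid_pt L N j - grid_pt L N i) =
       - (2 * pi * real N * of_int (j - i) / real M) + 2 * pi * of_int (j - i) / L * grid_pt L N (n + 1 + int N)"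
      using assms(1) M(1) by (simp add: grid_pt_def grid_h_def M_def[symmetric] field_simps)
    then show "cis (- (2 * pi * real N * of_int (j - i) / real M)) * cis (2 * pi * of_int (j - i) / L * grid_pt L N (n + 1 + int N))
       = cis (2 * pi * of_int n / L * (grid_pt L N j - grid_pt L N i))"
      by (simp only: cis_mult)
  qed (auto simp: M(2))
  also have "\<dots> = cis (- (2 * pi * real N * of_int (j - i) / real M)) * (if j - i = 0 then of_nat M else 0)"
    unfolding sum_distrib_left[symmetric] M_def
    using assms M by (subst sum_cis_grid) (auto simp: M_def)
  finally show ?thesis by (auto simp: M_def)
qed

lemma grid_norm_squared:
  assumes "L > 0"
  shows "(grid_norm L N w)\<^sup>2 = 1 / L * (\<Sum>j=1..int (grid_size N). grid_h L N * (cmod (w j))\<^sup>2)"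
proof -
  have "grid_h L N \<ge> 0" using assms by (simp add: grid_h_def)
  then have "0 \<le> (\<Sum>j=1..int (grid_size N). grid_h L N * (cmod (w j))\<^sup>2)"
    by (intro sum_nonneg) auto
  then show ?thesis using assms by (simp add: grid_norm_def)
qed

text \<open>Expanding the squared moduli and summing over wavenumbers first, dual orthogonality
  leaves only the diagonal i = j.\<close>

lemma grid_Parseval:
  assumes "L > 0"
  shows "(grid_norm L N w)\<^sup>2 = (\<Sum>k\<in>K_grid L N. (cmod (grid_coeff L N w k))\<^sup>2)"
proof -
  define M where "M = grid_size N"
  define I where "I = {1..int M}"
  let ?x = "grid_pt L N"
  have M: "M > 0" by (simp add: M_def grid_size_def)
  have hL: "grid_h L N / L = 1 / real M" using assms by (simp add: grid_h_def M_def)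
  have coeff: "grid_coeff L N w k = (1 / of_nat M) * (\<Sum>j\<in>I. cis (- (k * ?x j)) * w j)" for k
  proof -
    have "grid_coeff L N w k = of_real (grid_h L N / L) * (\<Sum>j\<in>I. cis (- (k * ?x j)) * w j)"
      by (simp add: grid_coeff_def sum_distrib_left I_def M_def mult_ac)
    then show ?thesis unfolding hL by simp
  qed
  have "complex_of_real (\<Sum>k\<in>K_grid L N. (cmod (grid_coeff L N w k))\<^sup>2)
      = (\<Sum>k\<in>K_grid L N. grid_coeff L N w k * cnj (grid_coeff L N w k))"
    by (simp only: of_real_sum complex_norm_square)
  also have "\<dots> = (\<Sum>k\<in>K_grid L N. \<Sum>i\<in>I. \<Sum>j\<in>I. (1 / of_nat M)\<^sup>2 * (w i * cnj (w j)) * cis (k * (?x j - ?x i)))"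
  proof (intro sum.cong refl)
    fix k
    have *: "cis (k * (?x j - ?x i)) = cis (- (k * ?x i)) * cnj (cis (- (k * ?x j)))" for i j
      by (simp add: cis_cnj cis_mult algebra_simps)
    show "grid_coeff L N w k * cnj (grid_coeff L N w k)
      = (\<Sum>i\<in>I. \<Sum>j\<in>I. (1 / of_nat M)\<^sup>2 * (w i * cnj (w j)) * cis (k * (?x j - ?x i)))"
      unfolding coeff * by (simp add: sum_product sum_distrib_left power2_eq_square mult_ac) (rule sum.swap)
  qed
  also have "\<dots> = (\<Sum>i\<in>I. \<Sum>j\<in>I. (1 / of_nat M)\<^sup>2 * (w i * cnj (w j)) * (\<Sum>k\<in>K_grid L N. cis (k * (?x j - ?x i))))"
    by (subst sum.swap, rule sum.cong[OF refl], subst sum.swap) (simp add: sum_distrib_left)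
  also have "\<dots> = (\<Sum>i\<in>I. \<Sum>j\<in>I. if i = j then (1 / of_nat M) * (w i * cnj (w i)) else 0)"
    using M by (intro sum.cong refl)
      (simp add: sum_cis_wavenumbers[OF assms] I_def M_def[symmetric] power2_eq_square)
  also have "\<dots> = (\<Sum>i\<in>I. (1 / of_nat M) * (w i * cnj (w i)))"
    by (simp add: I_def sum.delta')
  also have "\<dots> = complex_of_real (\<Sum>i\<in>I. (1 / of_nat M) * (cmod (w i))\<^sup>2)"
    unfolding of_real_sum of_real_mult complex_norm_square by simp
  also have "(\<Sum>i\<in>I. (1 / of_nat M) * (cmod (w i))\<^sup>2) = 1 / L * (\<Sum>j\<in>I. grid_h L N * (cmod (w j))\<^sup>2)"
    unfolding hL[symmetric] by (simp add: sum_distrib_left)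
  also have "\<dots> = (grid_norm L N w)\<^sup>2"
    by (simp only: grid_norm_squared[OF assms] I_def M_def)
  finally show ?thesis by (simp only: of_real_eq_iff)
qed

section \<open>The difference operator on discrete Fourier coefficients\<close>

lemma sum_shift_periodic:
  fixes f :: "int \<Rightarrow> 'a::comm_monoid_add"
  assumes "\<And>j. f (j + int M) = f j" "M > 0"
  shows "(\<Sum>j=1..int M. f (j + int l)) = (\<Sum>j=1..int M. f j)"
proof (induction l)
  case (Suc l)
  let ?f = "\<lambda>j. f (j + int l)"
  have "(\<Sum>j=1..int M. f (j + int (Suc l))) = (\<Sum>j=2..int M + 1. ?f j)"
    by (rule sum.reindex_bij_witness[of _ "\<lambda>j. j - 1" "\<lambda>j. j + 1"]) (auto simp: algebra_simps)
  also have "{2..int M + 1} = insert (int M + 1) {2..int M}" using assms(2) by auto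
  also have "sum ?f \<dots> = ?f (int M + 1) + sum ?f {2..int M}" by (subst sum.insert) auto
  also have "?f (int M + 1) = ?f 1" using assms(1)[of "1 + int l"] by (simp add: algebra_simps)
  also have "?f 1 + sum ?f {2..int M} = sum ?f (insert 1 {2..int M})" by (subst sum.insert) auto
  also have "insert 1 {2..int M} = {1..int M}" using assms(2) by auto
  finally show ?case using Suc by simp
qed simp

lemma cis_grid_periodic:
  assumes "L > 0" "k \<in> K_grid L N"
  shows "cis (k * grid_pt L N (j + int (grid_size N))) = cis (k * grid_pt L N j)"
proof -
  obtain n :: int where n: "k = 2 * pi * of_int n / L" using assms(2) by (auto simp: K_grid_def)
  have "real (grid_size N) * grid_h L N = L"
    by (simp add: grid_h_def grid_size_def del: of_nat_Suc of_nat_add)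
  then have "grid_pt L N (j + int (grid_size N)) = grid_pt L N j + L"
    by (simp add: grid_pt_def algebra_simps)
  then have "k * grid_pt L N (j + int (grid_size N)) = k * grid_pt L N j + 2 * pi * of_int n"
    using assms(1) by (simp add: n distrib_left)
  then show ?thesis by (simp add: cis_mult[symmetric] cis_multiple_2pi)
qed

text \<open>Summation by parts moves the difference operator onto the conjugate mode.\<close>

lemma grid_coeff_fd_op:
  assumes "L > 0" "k \<in> K_grid L N" "grid_vector N w"
  defines "h \<equiv> grid_h L N"
  shows "grid_coeff L N (fd_op r a h w) k = \<i> * of_real (k * P_hat r a (k * h)) * grid_coeff L N w k"
proof -
  define M where "M = grid_size N"
  have M: "M > 0" by (simp add: M_def grid_size_def)
  \<comment> \<open>The conjugate mode, written as the mode of wavenumber -k so that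
    \<open>fd_op_mode\<close> applies to it.\<close>
  define e where "e = (\<lambda>j. cis (- k * grid_pt L N j))"
  have "- k \<in> K_grid L N"
  proof -
    obtain n :: int where "k = 2 * pi * of_int n / L" "n \<in> {- int N..int N}"
      using assms(2) unfolding K_grid_def by blast
    then show ?thesis unfolding K_grid_def by (intro image_eqI[of _ _ "- n"]) auto
  qed
  then have ep: "e (j + int M) = e j" for j
    using cis_grid_periodic[OF assms(1)] by (simp only: e_def M_def)
  have wp: "w (j + int M) = w j" for j using assms(3) by (simp add: grid_vector_def M_def)
  have em: "e (j + int M - l) = e (j - l)" "w (j + int M - l) = w (j - l)" for j l
    using ep[of "j - l"] wp[of "j - l"] by (simp_all add: algebra_simps)
  have ea: "e (j + int M + l) = e (j + l)" "w (j + int M + l) = w (j + l)" for j l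
    using ep[of "j + l"] wp[of "j + l"] by (simp_all add: algebra_simps)
  have s1: "(\<Sum>j=1..int M. e j * w (j + int l)) = (\<Sum>j=1..int M. e (j - int l) * w j)" for l
    using sum_shift_periodic[of "\<lambda>j. e (j - int l) * w j" M l] M by (simp add: em wp)
  have s2: "(\<Sum>j=1..int M. e j * w (j - int l)) = (\<Sum>j=1..int M. e (j + int l) * w j)" for l
    using sum_shift_periodic[of "\<lambda>j. e j * w (j - int l)" M l] M by (simp add: em ep)
  have "(\<Sum>j=1..int M. e j * fd_op r a h w j)
      = of_real (1 / h) * (\<Sum>l=1..r. of_real (a l) * ((\<Sum>j=1..int M. e j * w (j + int l)) - (\<Sum>j=1..int M. e j * w (j - int l))))"
    unfolding fd_op_def
    by (simp add: sum_distrib_left sum_subtractf right_diff_distrib sum.swap[of _ "{1..int M}"] mult_ac)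
  \<comment> \<open>The centered operator is antisymmetric for the periodic sum, hence the minus
    sign. It cancels the one from the wavenumber -k, the symbol being even.\<close>
  also have "\<dots> = (\<Sum>j=1..int M. - fd_op r a h e j * w j)"
    unfolding fd_op_def s1 s2
    by (simp add: sum_distrib_left sum_distrib_right sum_subtractf right_diff_distrib left_diff_distrib
        sum.swap[of _ "{1..int M}"] mult_ac sum_negf)
  also have "\<dots> = \<i> * of_real (k * P_hat r a (k * h)) * (\<Sum>j=1..int M. e j * w j)"
    unfolding e_def h_def fd_op_mode[OF assms(1)]
    by (simp add: P_hat_minus sum_distrib_left mult_ac)
  finally have *: "(\<Sum>j=1..int M. e j * fd_op r a h w j) = \<i> * of_real (k * P_hat r a (k * h)) * (\<Sum>j=1..int M. e j * w j)" .
  have gc: "grid_coeff L N v k = of_real (h / L) * (\<Sum>j=1..int M. e j * v j)" for v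
    by (simp add: grid_coeff_def h_def M_def e_def sum_distrib_left mult_ac)
  show ?thesis unfolding gc * by (simp add: mult_ac)
qed

text \<open>Taking a discrete Fourier coefficient is linear and turns the difference operator into a
  scalar factor, so each coefficient solves a forced oscillator equation.\<close>

lemma semidiscrete_coeff:
  assumes "L > 0" "k \<in> K_grid L N" "t \<ge> 0" "semidiscrete_solution L c v0 g r a F N w"
  defines "\<kappa> \<equiv> k * grid_h L N"
  shows "grid_coeff L N (w t) k =
    of_real (1 / L) * (of_real (F \<kappa>) * cis (- (k * c * P_hat r a \<kappa> * t)) * osc_integral g t (k * (c * P_hat r a \<kappa> - v0)))"
proof -
  let ?h = "grid_h L N"
  define y where "y = (\<lambda>s. grid_coeff L N (w s) k)"
  have y': "(y has_vector_derivative
      (of_real (g s) * (of_real (F \<kappa> / L) * cis (- ((k * v0) * s))) - \<i> * of_real (k * c * P_hat r a \<kappa>) * y s))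
      (at s within {0..})" if s: "s \<ge> 0" for s
  proof -
    let ?w' = "\<lambda>j. of_real (g s) * discrete_delta L N F (v0 * s) j - of_real c * fd_op r a ?h (w s) j"
    have D: "((\<lambda>\<tau>. w \<tau> j) has_vector_derivative ?w' j) (at s within {0..})" for j
      using assms(4) s by (simp add: semidiscrete_solution_def)
    have "(y has_vector_derivative grid_coeff L N ?w' k) (at s within {0..})"
      unfolding y_def grid_coeff_def
      by (intro has_vector_derivative_mult_right has_vector_derivative_sum D)
    moreover have "grid_vector N (w s)" using assms(4) s by (simp add: semidiscrete_solution_def)
    ultimately show ?thesis
      by (simp add: grid_coeff_diff grid_coeff_cmult grid_coeff_fd_op[OF assms(1,2)]
          grid_coeff_discrete_delta[OF assms(1,2)] y_def \<kappa>_def mult_ac)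
  qed
  have "w 0 = (\<lambda>j. 0)" using assms(4) by (auto simp: semidiscrete_solution_def)
  then have "y 0 = 0" by (simp add: y_def grid_coeff_def)
  from forced_oscillator_solution[of t y g, OF assms(3) this y']
  have "y t = of_real (F \<kappa> / L) * cis (- (k * c * P_hat r a \<kappa> * t)) * osc_integral g t (k * c * P_hat r a \<kappa> - k * v0)" .
  then show ?thesis by (simp add: y_def right_diff_distrib mult_ac)
qed

subsection \<open>The convergence theorem\<close>

lemma exact_coeff:
  fixes y :: "real \<Rightarrow> complex"
  assumes "t \<ge> 0" "y 0 = 0"
    and "\<And>t. t \<ge> 0 \<Longrightarrow> (y has_vector_derivative
            (of_real (g t / L) * cis (- (k * v0 * t)) - \<i> * of_real (k * c) * y t)) (at t within {0..})"
  shows "y t = of_real (1 / L) * (cis (- (k * c * t)) * osc_integral g t (k * (c - v0)))"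
proof -
  have "y t = of_real (1 / L) * cis (- (k * c * t)) * osc_integral g t (k * c - k * v0)"
    by (rule forced_oscillator_solution[of t y g, OF assms(1,2)])
       (use assms(3) in \<open>simp add: mult_ac\<close>)
  then show ?thesis by (simp add: right_diff_distrib)
qed

text \<open>Pointwise (a + T)^2 \<le> 2 a^2 + 2 T^2, and the grid weights h / L add up to one. It
  lets a perturbation known only in the maximum norm be split off.\<close>

lemma grid_norm_diff_squared_le:
  assumes "L > 0" "\<And>j. cmod (z j) \<le> T"
  shows "(grid_norm L N (\<lambda>j. v j - z j))\<^sup>2 \<le> 2 * (grid_norm L N v)\<^sup>2 + 2 * T\<^sup>2"
proof -
  let ?I = "{1..int (grid_size N)}" and ?h = "grid_h L N"
  have h: "?h \<ge> 0" using assms(1) by (simp add: grid_h_def)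
  have pt: "(cmod (v j - z j))\<^sup>2 \<le> 2 * (cmod (v j))\<^sup>2 + 2 * T\<^sup>2" for j
  proof -
    have "cmod (v j - z j) \<le> cmod (v j) + T"
      using norm_triangle_ineq4[of "v j" "z j"] assms(2)[of j] by linarith
    then have "(cmod (v j - z j))\<^sup>2 \<le> (cmod (v j) + T)\<^sup>2" by (intro power_mono) auto
    also have "\<dots> \<le> 2 * (cmod (v j))\<^sup>2 + 2 * T\<^sup>2"
      using zero_le_power2[of "cmod (v j) - T"] by (simp add: power2_eq_square algebra_simps)
    finally show ?thesis .
  qed
  have "1 / L * (\<Sum>j\<in>?I. ?h * (cmod (v j - z j))\<^sup>2) \<le> 1 / L * (\<Sum>j\<in>?I. ?h * (2 * (cmod (v j))\<^sup>2 + 2 * T\<^sup>2))"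
    using assms(1) h by (intro mult_left_mono sum_mono pt) auto
  also have "\<dots> = 2 * (1 / L * (\<Sum>j\<in>?I. ?h * (cmod (v j))\<^sup>2)) + 1 / L * (real (grid_size N) * ?h) * (2 * T\<^sup>2)"
    by (simp add: sum.distrib sum_distrib_left algebra_simps)
  also have "1 / L * (real (grid_size N) * ?h) = 1"
    using assms(1) by (simp add: grid_h_def grid_size_def)
  finally show ?thesis unfolding grid_norm_squared[OF assms(1)] by simp
qed

theorem theorem2:
  fixes p r :: nat and L c v0 t1 :: real and a :: "nat \<Rightarrow> real"
    and g F :: "real \<Rightarrow> real"
    and u :: "real \<Rightarrow> real \<Rightarrow> complex"
    and w :: "nat \<Rightarrow> real \<Rightarrow> int \<Rightarrow> complex"
  assumes "p \<ge> 1" and "L > 0" and "c > 0" and "v0 < c" and "t1 > 0"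
    and "order_accurate p (P_hat r a)"
    and "strictly_decreasing_abs (P_hat r a)"
    and "sonic_exists (P_hat r a) c v0 \<Longrightarrow>
           deriv (P_hat r a) (kappa_star (P_hat r a) c v0) \<noteq> 0"
    and "times_cont_diff (p + 2) g"
    and "\<And>t. t \<le> 0 \<Longrightarrow> g t = 0" and "\<And>t. t \<ge> t1 \<Longrightarrow> g t = 0"
    and "admissible_profile (P_hat r a) c v0 F"
    and "moment_conditions (P_hat r a) c v0 p F"
    and "sonic_boom_conditions (P_hat r a) c v0 (p + 1) F"
    and "exact_solution L c v0 g t1 u"
    and "\<And>N. N \<ge> 1 \<Longrightarrow> semidiscrete_solution L c v0 g r a F N (w N)"
  shows "\<forall>t\<ge>t1. \<exists>C. \<forall>N\<ge>1.
           grid_norm L N (\<lambda>j. w N t j - u (grid_pt L N j) t) \<le> C * grid_h L N ^ p"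
proof (intro allI impI)
  fix t assume t1: "t \<ge> t1"
  with assms(5) have t: "t \<ge> 0" by simp
  define G where "G = osc_integral g t"
  define d where "d = c - v0"
  have d: "d > 0" using assms by (simp add: d_def)
  obtain uh :: "real \<Rightarrow> real \<Rightarrow> complex" where
    uh_ode: "\<And>k. k \<in> K_inf L \<Longrightarrow> uh k 0 = 0"
      "\<And>k t. k \<in> K_inf L \<Longrightarrow> t \<ge> 0 \<Longrightarrow> (uh k has_vector_derivative
            (of_real (g t / L) * cis (- (k * v0 * t)) - \<i> * of_real (k * c) * uh k t)) (at t within {0..})"
    and uh_sum: "\<And>x. ((\<lambda>k. uh k t * cis (k * x)) has_sum u x t) (K_inf L)"
    using assms(15) t1 unfolding exact_solution_def by blast
  have uh: "uh k t = of_real (1 / L) * (cis (- (k * c * t)) * G (k * d))" if "k \<in> K_inf L" for k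
    unfolding G_def d_def by (rule exact_coeff[OF t uh_ode(1)[OF that] uh_ode(2)[OF that]])
  obtain S where S: "S \<ge> 0" "\<And>A. finite A \<Longrightarrow> A \<subseteq> K_inf L - {0} \<Longrightarrow> (\<Sum>k\<in>A. 1 / k\<^sup>2) \<le> S"
    using sum_inverse_squares_K_inf[OF assms(2)] by blast
  have k0: "2 * pi / L > 0" using assms(2) by simp
  obtain C where C: "C \<ge> 0"
    "\<And>k h. h > 0 \<Longrightarrow> \<bar>k\<bar> \<ge> 2 * pi / L \<Longrightarrow> \<bar>k * h\<bar> \<le> pi \<Longrightarrow>
      cmod (of_real (F (k * h)) * cis (- (k * c * P_hat r a (k * h) * t)) * G (k * (c * P_hat r a (k * h) - v0))
        - cis (- (k * c * t)) * G (k * d)) \<le> C * h ^ p / \<bar>k\<bar>"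
    using mode_error_bound[OF assms(1,3,4,5) k0 t1 assms(6-14)] unfolding G_def d_def by blast
  obtain B where B: "B \<ge> 0" "\<And>\<omega>. \<bar>\<omega>\<bar> ^ (p + 2) * cmod (G \<omega>) \<le> B"
    unfolding G_def by (rule osc_integral_decay[OF assms(9-11) t1 t, of "p + 2"]) auto
  \<comment> \<open>Of the p + 2 powers of 1 / |k| in the decay, p become h^p through |k| \<ge> pi /
    h, and the other two are summed by \<open>S\<close>.\<close>
  define T where "T = B / (L * d ^ (p + 2) * pi ^ p) * S"
  define Q where "Q = sqrt (2 * ((C / L)\<^sup>2 * S) + 2 * T\<^sup>2)"
  have "grid_norm L N (\<lambda>j. w N t j - u (grid_pt L N j) t) \<le> Q * grid_h L N ^ p" if N: "N \<ge> 1" for N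
  proof -
    define h where "h = grid_h L N"
    have h: "h > 0" using assms(2) by (simp add: h_def grid_h_def grid_size_def)
    \<comment> \<open>The exact Fourier series truncated to the grid wavenumbers. Its discrete
      coefficients are \<open>uh k t\<close>, free of aliasing.\<close>
    define v where "v = (\<lambda>x. \<Sum>k\<in>K_grid L N. uh k t * cis (k * x))"
    have tail: "cmod (u x t - v x) \<le> T * h ^ p" for x
    proof (rule norm_has_sum_le)
      show "((\<lambda>k. uh k t * cis (k * x)) has_sum (u x t - v x)) (K_inf L - K_grid L N)"
        unfolding v_def by (intro has_sum_Diff uh_sum has_sum_finite K_grid_subset_K_inf) simp
      fix A assume A: "finite A" "A \<subseteq> K_inf L - K_grid L N"
      \<comment> \<open>So off-grid wavenumbers are nonzero and \<open>S\<close> applies to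
        them.\<close>
      have z: "0 \<in> K_grid L N" unfolding K_grid_def by (rule image_eqI[of _ _ 0]) auto
      have "cmod (uh k t * cis (k * x)) \<le> B / (L * d ^ (p + 2) * pi ^ p) * h ^ p * (1 / k\<^sup>2)" if k: "k \<in> A" for k
      proof -
        have k': "k \<in> K_inf L" "\<bar>k\<bar> > 0" using A k z by auto
        have "pi \<le> \<bar>k\<bar> * h" using off_grid_abs_ge[OF assms(2), of k N] A k h by (auto simp: abs_mult h_def)
        then have kh: "pi / h \<le> \<bar>k\<bar>" using h by (simp add: pos_divide_le_eq)
        have "(pi / h) ^ p * (\<bar>k\<bar> ^ 2 * (d ^ (p + 2) * cmod (G (k * d)))) \<le> \<bar>k\<bar> ^ p * (\<bar>k\<bar> ^ 2 * (d ^ (p + 2) * cmod (G (k * d))))"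
          using kh h d by (intro mult_right_mono power_mono) auto
        also have "\<dots> = \<bar>k * d\<bar> ^ (p + 2) * cmod (G (k * d))"
          using d by (simp add: abs_mult power_mult_distrib power_add power2_eq_square)
        also have "\<dots> \<le> B" by (rule B(2))
        finally have "cmod (G (k * d)) \<le> B / (d ^ (p + 2) * pi ^ p) * h ^ p * (1 / k\<^sup>2)"
          using h d k' by (simp add: field_simps power_divide)
        then have "1 / L * cmod (G (k * d)) \<le> 1 / L * (B / (d ^ (p + 2) * pi ^ p) * h ^ p * (1 / k\<^sup>2))"
          using assms(2) by (intro mult_left_mono) auto
        then show ?thesis using assms(2) uh[OF k'(1)] by (simp add: norm_mult norm_divide mult_ac)
      qed
      then have "(\<Sum>k\<in>A. cmod (uh k t * cis (k * x))) \<le> (\<Sum>k\<in>A. B / (L * d ^ (p + 2) * pi ^ p) * h ^ p * (1 / k\<^sup>2))"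
        by (rule sum_mono)
      also have "\<dots> = B / (L * d ^ (p + 2) * pi ^ p) * h ^ p * (\<Sum>k\<in>A. 1 / k\<^sup>2)"
        by (simp only: sum_distrib_left)
      also have "\<dots> \<le> B / (L * d ^ (p + 2) * pi ^ p) * h ^ p * S"
        using A z B h d assms(2) by (intro mult_left_mono S(2)) auto
      finally show "(\<Sum>k\<in>A. cmod (uh k t * cis (k * x))) \<le> T * h ^ p"
        by (simp add: T_def mult_ac)
    qed
    let ?D = "\<lambda>j. w N t j - v (grid_pt L N j)"
    have coeff: "cmod (grid_coeff L N ?D k) \<le> (if k = 0 then 0 else C / L * h ^ p * (1 / \<bar>k\<bar>))"
      if k: "k \<in> K_grid L N" for k
    proof -
      have kinf: "k \<in> K_inf L" using k K_grid_subset_K_inf by blast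
      define E where "E = of_real (F (k * h)) * cis (- (k * c * P_hat r a (k * h) * t)) * G (k * (c * P_hat r a (k * h) - v0))
        - cis (- (k * c * t)) * G (k * d)"
      have "grid_coeff L N ?D k = grid_coeff L N (w N t) k - uh k t"
        unfolding grid_coeff_diff v_def using grid_coeff_expansion[OF assms(2) k, of "\<lambda>k. uh k t"] by simp
      also have "\<dots> = of_real (1 / L) * E"
        unfolding semidiscrete_coeff[OF assms(2) k t assms(16)[OF N]] uh[OF kinf] E_def G_def h_def
        by (simp only: right_diff_distrib)
      finally have eq: "cmod (grid_coeff L N ?D k) = 1 / L * cmod E"
        using assms(2) by (simp add: norm_mult norm_divide)
      show ?thesis
      proof (cases "k = 0")
        case True
        \<comment> \<open>The mean value is exact: F 0 = 1, and all phases and frequencies are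
          zero.\<close>
        then have "E = 0" using assms(13) by (simp add: E_def moment_conditions_def)
        then show ?thesis using eq True by simp
      next
        case False
        have "cmod E \<le> C * h ^ p / \<bar>k\<bar>"
          unfolding E_def using K_grid_abs_le[OF assms(2) k] K_inf_abs_ge[OF assms(2) kinf False] h
          by (intro C(2)) (auto simp: h_def)
        then have "1 / L * cmod E \<le> 1 / L * (C * h ^ p / \<bar>k\<bar>)"
          using assms(2) by (intro mult_left_mono) auto
        then show ?thesis using eq False by simp
      qed
    qed
    have "(grid_norm L N ?D)\<^sup>2 = (\<Sum>k\<in>K_grid L N. (cmod (grid_coeff L N ?D k))\<^sup>2)"
      by (rule grid_Parseval[OF assms(2)])
    also have "\<dots> \<le> (\<Sum>k\<in>K_grid L N. (if k = 0 then 0 else C / L * h ^ p * (1 / \<bar>k\<bar>))\<^sup>2)"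
      by (intro sum_mono power_mono coeff) auto
    also have "\<dots> = (\<Sum>k\<in>K_grid L N - {0}. (if k = 0 then 0 else C / L * h ^ p * (1 / \<bar>k\<bar>))\<^sup>2)"
      by (rule sum.mono_neutral_right) auto
    also have "\<dots> = (C / L * h ^ p)\<^sup>2 * (\<Sum>k\<in>K_grid L N - {0}. 1 / k\<^sup>2)"
      unfolding sum_distrib_left by (intro sum.cong refl) (auto simp: power_mult_distrib power_divide)
    also have "\<dots> \<le> (C / L * h ^ p)\<^sup>2 * S"
      using K_grid_subset_K_inf[of L N] by (intro mult_left_mono S(2)) auto
    finally have main: "(grid_norm L N ?D)\<^sup>2 \<le> (C / L * h ^ p)\<^sup>2 * S" .
    \<comment> \<open>The error is the resolved part \<open>?D\<close> minus the tail u - v at the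
      grid points.\<close>
    have "(grid_norm L N (\<lambda>j. ?D j - (u (grid_pt L N j) t - v (grid_pt L N j))))\<^sup>2
        \<le> 2 * (grid_norm L N ?D)\<^sup>2 + 2 * (T * h ^ p)\<^sup>2"
      by (rule grid_norm_diff_squared_le[OF assms(2) tail])
    also have "\<dots> \<le> 2 * ((C / L * h ^ p)\<^sup>2 * S) + 2 * (T * h ^ p)\<^sup>2"
      using main by simp
    also have "\<dots> = (2 * ((C / L)\<^sup>2 * S) + 2 * T\<^sup>2) * (h ^ p)\<^sup>2"
      by (simp add: power_mult_distrib power_divide algebra_simps)
    also have "\<dots> = (Q * h ^ p)\<^sup>2"
      unfolding Q_def power_mult_distrib using S(1) by (subst real_sqrt_pow2) auto
    finally have "(grid_norm L N (\<lambda>j. w N t j - u (grid_pt L N j) t))\<^sup>2 \<le> (Q * h ^ p)\<^sup>2"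
      by simp
    then show ?thesis
      unfolding h_def[symmetric] by (rule power2_le_imp_le) (use S(1) h in \<open>simp add: Q_def\<close>)
  qed
  then show "\<exists>C. \<forall>N\<ge>1. grid_norm L N (\<lambda>j. w N t j - u (grid_pt L N j) t) \<le> C * grid_h L N ^ p"
    by blast
qed

end
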